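(* Let $1\le p<\infty$ and let $\Lambda$ be a positive non-increasing continuous function on $(0,1]$. Then the function $S(z)=e^{-\frac{1+z}{1-z}}$ is cyclic in $\mathcal{B}_\Lambda^p$ if and only if $$\int_0^1\sqrt{\frac{\Lambda(t)}{t}}\,dt=\infty .$$
   Context: $\mathbb{D}$ is the open unit disc of $\mathbb{C}$. $\mathcal{B}_\Lambda^p$ is the space of all analytic functions $f$ on $\mathbb{D}$ with $$\|f\|_{\Lambda,p}^p=\int_{\mathbb{D}}|f(z)|^pe^{-p\Lambda(1-|z|)}\,dA(z)<+\infty,$$ where $dA$ is area measure. An element $f$ of a space $X$ of analytic functions on $\mathbb{D}$, invariant under multiplication by $z$, is called cyclic in $X$ if the closure in $X$ of $\{pf: p\text{ a polynomial}\}$ equals $X$. *)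

theory Defs
  imports "HOL-Complex_Analysis.Complex_Analysis" "HOL-Computational_Algebra.Polynomial"
begin

text \<open>
  Analytic functions on the unit disc are represented by total functions that are holomorphic
  on \<^term>\<open>ball 0 1 :: complex set\<close>; their values outside the disc are irrelevant to all notions below.
\<close>

definition weighted_integral :: "(real \<Rightarrow> real) \<Rightarrow> real \<Rightarrow> (complex \<Rightarrow> complex) \<Rightarrow> ennreal" where
  "weighted_integral \<Lambda> p f =
     (\<integral>\<^sup>+ z \<in> ball 0 1. ennreal (cmod (f z) powr p * exp (- p * \<Lambda> (1 - cmod z))) \<partial>lborel)"

definition weighted_Bergman :: "(real \<Rightarrow> real) \<Rightarrow> real \<Rightarrow> (complex \<Rightarrow> complex) set" where
  "weighted_Bergman \<Lambda> p = {f. f holomorphic_on ball 0 1 \<and> weighted_integral \<Lambda> p f < \<infinity>}"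

text \<open>Only meaningful on \<^const>\<open>weighted_Bergman\<close>: an infinite integral would be sent to 0.\<close>

definition weighted_norm :: "(real \<Rightarrow> real) \<Rightarrow> real \<Rightarrow> (complex \<Rightarrow> complex) \<Rightarrow> real" where
  "weighted_norm \<Lambda> p f = enn2real (weighted_integral \<Lambda> p f) powr (1 / p)"

definition norm_closure_in ::
    "(complex \<Rightarrow> complex) set \<Rightarrow> ((complex \<Rightarrow> complex) \<Rightarrow> real) \<Rightarrow>
     (complex \<Rightarrow> complex) set \<Rightarrow> (complex \<Rightarrow> complex) set" where
  "norm_closure_in X N E = {g \<in> X. \<forall>e>0. \<exists>h\<in>E. N (\<lambda>z. h z - g z) < e}"

definition cyclic_in ::
    "(complex \<Rightarrow> complex) set \<Rightarrow> ((complex \<Rightarrow> complex) \<Rightarrow> real) \<Rightarrow> (complex \<Rightarrow> complex) \<Rightarrow> bool" where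
  "cyclic_in X N f \<longleftrightarrow>
     f \<in> X \<and> norm_closure_in X N {(\<lambda>z. poly q z * f z) | q. True} = X"

definition atomic_inner :: "complex \<Rightarrow> complex" where
  "atomic_inner z = exp (- ((1 + z) / (1 - z)))"

text \<open>
  The following lemmas show that every difference whose norm is taken in \<^const>\<open>cyclic_in\<close> lies in the
  space, so that \<^const>\<open>weighted_norm\<close> is never applied to a function with infinite integral.
\<close>

lemma weighted_integrand_measurable:
  assumes p: "p \<ge> 1" and \<Lambda>: "continuous_on {0<..1} \<Lambda>" and f: "f holomorphic_on ball 0 1"
  shows "(\<lambda>z. ennreal (cmod (f z) powr p * exp (- p * \<Lambda> (1 - cmod z))) * indicator (ball 0 1) z)
           \<in> borel_measurable lborel"
proof -
  have "continuous_on (ball 0 1) (\<lambda>z::complex. \<Lambda> (1 - cmod z))"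
    by (rule continuous_on_compose2[OF \<Lambda>]) (auto intro!: continuous_intros)
  moreover have "continuous_on (ball 0 1) (\<lambda>z. cmod (f z) powr p)"
    by (rule continuous_on_powr')
      (use p holomorphic_on_imp_continuous_on[OF f] in \<open>auto intro!: continuous_intros\<close>)
  ultimately have "continuous_on (ball 0 1)
      (\<lambda>z. cmod (f z) powr p * exp (- p * \<Lambda> (1 - cmod z)))"
    by (intro continuous_on_mult continuous_on_exp continuous_on_const)
  then have "(\<lambda>z. indicator (ball 0 1) z *\<^sub>R
      (cmod (f z) powr p * exp (- p * \<Lambda> (1 - cmod z)))) \<in> borel_measurable borel"
    by (intro borel_measurable_continuous_on_indicator) auto
  then have "(\<lambda>z. ennreal (indicator (ball 0 1) z *\<^sub>R
      (cmod (f z) powr p * exp (- p * \<Lambda> (1 - cmod z))))) \<in> borel_measurable lborel"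
    by simp
  also have "(\<lambda>z. ennreal (indicator (ball 0 1) z *\<^sub>R
      (cmod (f z) powr p * exp (- p * \<Lambda> (1 - cmod z))))) =
    (\<lambda>z. ennreal (cmod (f z) powr p * exp (- p * \<Lambda> (1 - cmod z))) * indicator (ball 0 1) z)"
    by (auto simp: fun_eq_iff indicator_def)
  finally show ?thesis .
qed

lemma weighted_Bergman_poly_mult:
  assumes p: "p \<ge> 1" and \<Lambda>: "continuous_on {0<..1} \<Lambda>" and f: "f \<in> weighted_Bergman \<Lambda> p"
  shows "(\<lambda>z. poly q z * f z) \<in> weighted_Bergman \<Lambda> p"
proof -
  have fh: "f holomorphic_on ball 0 1" and fi: "weighted_integral \<Lambda> p f < \<infinity>"
    using f by (auto simp: weighted_Bergman_def)
  have "compact (poly q ` cball 0 1)"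
    by (intro compact_continuous_image continuous_intros) auto
  then obtain B where B: "\<And>z. z \<in> cball 0 1 \<Longrightarrow> cmod (poly q z) \<le> B"
    using compact_imp_bounded bounded_iff by (metis (no_types, lifting) imageI)
  define w where "w z = exp (- p * \<Lambda> (1 - cmod z))" for z
  have le: "cmod (poly q z * f z) powr p * w z \<le> B powr p * (cmod (f z) powr p * w z)"
    if "z \<in> ball 0 1" for z
  proof -
    have "cmod (poly q z) powr p \<le> B powr p"
      using B[of z] that p by (intro powr_mono2) auto
    then show ?thesis
      by (simp add: norm_mult powr_mult mult_right_mono w_def flip: mult.assoc)
  qed
  have "weighted_integral \<Lambda> p (\<lambda>z. poly q z * f z)
      \<le> (\<integral>\<^sup>+ z. ennreal (B powr p) *
           (ennreal (cmod (f z) powr p * w z) * indicator (ball 0 1) z) \<partial>lborel)"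
    unfolding weighted_integral_def w_def[symmetric]
  proof (intro nn_integral_mono)
    fix z :: complex
    show "ennreal (cmod (poly q z * f z) powr p * w z) * indicator (ball 0 1) z
      \<le> ennreal (B powr p) * (ennreal (cmod (f z) powr p * w z) * indicator (ball 0 1) z)"
      using ennreal_leI[OF le[of z]]
      by (cases "z \<in> ball 0 1") (auto simp: ennreal_mult')
  qed
  also have "\<dots> = ennreal (B powr p) * weighted_integral \<Lambda> p f"
    unfolding weighted_integral_def w_def
    by (intro nn_integral_cmult weighted_integrand_measurable p \<Lambda> fh)
  also have "\<dots> < \<infinity>"
    using fi by (simp add: ennreal_mult_less_top)
  finally show ?thesis
    using fh by (auto simp: weighted_Bergman_def intro!: holomorphic_intros)
qed

lemma weighted_Bergman_diff:
  assumes p: "p \<ge> 1" and \<Lambda>: "continuous_on {0<..1} \<Lambda>"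
    and f: "f \<in> weighted_Bergman \<Lambda> p" and g: "g \<in> weighted_Bergman \<Lambda> p"
  shows "(\<lambda>z. f z - g z) \<in> weighted_Bergman \<Lambda> p"
proof -
  have fh: "f holomorphic_on ball 0 1" and fi: "weighted_integral \<Lambda> p f < \<infinity>"
    and gh: "g holomorphic_on ball 0 1" and gi: "weighted_integral \<Lambda> p g < \<infinity>"
    using f g by (auto simp: weighted_Bergman_def)
  define w where "w z = exp (- p * \<Lambda> (1 - cmod z))" for z
  have le: "cmod (f z - g z) powr p * w z
      \<le> 2 powr p * (cmod (f z) powr p * w z + cmod (g z) powr p * w z)" for z
  proof -
    define m where "m = max (cmod (f z)) (cmod (g z))"
    have "cmod (f z - g z) \<le> 2 * m"
      using norm_triangle_ineq4[of "f z" "g z"] by (auto simp: m_def max_def)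
    then have "cmod (f z - g z) powr p \<le> (2 * m) powr p"
      using p by (intro powr_mono2) auto
    also have "\<dots> = 2 powr p * m powr p"
      by (rule powr_mult)
    also have "m powr p \<le> cmod (f z) powr p + cmod (g z) powr p"
      by (auto simp: m_def max_def)
    finally have "cmod (f z - g z) powr p \<le> 2 powr p * (cmod (f z) powr p + cmod (g z) powr p)"
      by simp
    then have "cmod (f z - g z) powr p * w z
        \<le> 2 powr p * (cmod (f z) powr p + cmod (g z) powr p) * w z"
      by (rule mult_right_mono) (simp add: w_def)
    then show ?thesis
      by (simp add: algebra_simps)
  qed
  have "weighted_integral \<Lambda> p (\<lambda>z. f z - g z)
      \<le> (\<integral>\<^sup>+ z. ennreal (2 powr p) *
           (ennreal (cmod (f z) powr p * w z) * indicator (ball 0 1) z +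
            ennreal (cmod (g z) powr p * w z) * indicator (ball 0 1) z) \<partial>lborel)"
    unfolding weighted_integral_def w_def[symmetric]
  proof (intro nn_integral_mono)
    fix z :: complex
    have "0 \<le> w z" by (simp add: w_def)
    then show "ennreal (cmod (f z - g z) powr p * w z) * indicator (ball 0 1) z
      \<le> ennreal (2 powr p) * (ennreal (cmod (f z) powr p * w z) * indicator (ball 0 1) z +
            ennreal (cmod (g z) powr p * w z) * indicator (ball 0 1) z)"
      using ennreal_leI[OF le[of z]]
      by (cases "z \<in> ball 0 1") (auto simp: ennreal_mult' ennreal_plus)
  qed
  also have "\<dots> = ennreal (2 powr p) * (weighted_integral \<Lambda> p f + weighted_integral \<Lambda> p g)"
    unfolding weighted_integral_def w_def
    using weighted_integrand_measurable[OF p \<Lambda> fh] weighted_integrand_measurable[OF p \<Lambda> gh]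
    by (subst nn_integral_cmult) (simp_all add: nn_integral_add)
  also have "\<dots> < \<infinity>"
    using fi gi by (simp add: ennreal_mult_less_top)
  finally show ?thesis
    using fh gh by (auto simp: weighted_Bergman_def intro!: holomorphic_intros)
qed

end

theory Submission
  imports Defs "HOL-Real_Asymp.Real_Asymp"
begin

text \<open>
  Write \<open>A = (1 + z) / (1 - z)\<close>, so that \<open>S = exp (- A)\<close>, and \<open>t = 1 - \<bar>z\<bar>\<close>; then \<open>Re A \<ge> \<bar>A\<bar>\<^sup>2 t / 4\<close>.

  Divergence implies cyclicity. Expanding \<open>1 = (s + (1 - s)) ^ (2 n)\<close> for \<open>s = exp (- h A / n)\<close> gives
  \<open>1 = exp (- h A) P + E\<close> with \<open>\<bar>P\<bar> \<le> 8 ^ n\<close> and \<open>\<bar>E\<bar> \<le> (8 h \<bar>A\<bar> / n) ^ n\<close>, \<open>\<bar>E\<bar> \<le> 16 ^ n\<close>. If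
  \<open>\<Lambda> \<ge> 5 n\<close> on \<open>(0, T)\<close>, then with \<open>h = sqrt (\<delta> n T) / 32\<close> the error \<open>E exp (- \<delta> A)\<close> is at most \<open>4 ^ - n\<close> with
  respect to the weight. Multiplying these identities for \<open>n = 4 ^ k\<close>, \<open>T = T k\<close>, the total shift is
  a multiple of \<open>\<Sum>k. 2 ^ k sqrt (T k)\<close>, which diverges together with the integral. Hence
  \<open>exp (- \<delta> A)\<close> is a limit of bounded multiples of \<open>S\<close> for every \<open>\<delta> > 0\<close>, and so is \<open>1\<close>.

  Convergence excludes cyclicity. If \<open>q S\<close> is close to \<open>1\<close> in norm, then \<open>log \<bar>q\<bar> \<le> Re A + L t\<close> where
  the integral for \<open>L\<close> still converges. There is a positive harmonic function \<open>H\<close>, a sum of terms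
  \<open>4 ^ k Re (W / (W + r k))\<close> with \<open>W = 1 + A\<close>, such that \<open>L t \<le> C + 4 H\<close> where \<open>Re A = 1 + H\<close>, although
  \<open>H \<le> W / 20\<close> on the radius. By the maximum principle \<open>log \<bar>q\<bar> \<le> C + 5 (1 + H)\<close> on \<open>{Re A > 1 + H}\<close>, which
  contradicts \<open>log \<bar>q\<bar> \<approx> A\<close> at a point of the radius close to \<open>1\<close>.
\<close>

subsection \<open>Area mean values\<close>

text \<open>Orthogonal maps of \<open>real^2\<close> preserve Lebesgue measure; \<open>V\<close> and
  \<open>L\<close> carry this over to the complex plane, since they match boxes with boxes.\<close>

lemma distr_rotation_lborel:
  "distr lborel borel (\<lambda>w::complex. cis \<theta> * w) = lborel"
proof (rule lborel_eqI[symmetric])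
  fix l u :: complex
  assume lu: "\<And>b. b \<in> Basis \<Longrightarrow> l \<bullet> b \<le> u \<bullet> b"
  define V :: "real^2 \<Rightarrow> complex" where "V v = Complex (v $ 1) (v $ 2)" for v
  define L :: "complex \<Rightarrow> real^2" where "L z = vector [Re z, Im z]" for z
  define R :: "real^2 \<Rightarrow> real^2" where "R v = L (cis \<theta> * V v)" for v
  have VL [simp]: "V (L z) = z" for z by (simp add: V_def L_def complex_eq_iff)
  have LV [simp]: "L (V v) = v" for v by (simp add: V_def L_def vec_eq_iff forall_2)
  have V_meas: "V \<in> borel_measurable borel"
    unfolding V_def by (intro borel_measurable_continuous_onI) (auto simp: Complex_eq intro!: continuous_intros)
  have V_box: "V -` box a b = box (L a) (L b)" for a b
    by (auto simp: V_def L_def mem_box_cart forall_2 in_box_complex_iff)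
  have BC: "(\<Prod>b\<in>Basis. (y - x) \<bullet> b) = (Re y - Re x) * (Im y - Im x)" for x y :: complex
    by (simp add: Basis_complex_def)
  have dV: "distr lborel borel V = lborel"
  proof (rule lborel_eqI[symmetric])
    fix a b :: complex
    assume ab: "\<And>i. i \<in> Basis \<Longrightarrow> a \<bullet> i \<le> b \<bullet> i"
    then have "Re a \<le> Re b" "Im a \<le> Im b"
      using ab[of 1] ab[of \<i>] by (auto simp: Basis_complex_def)
    then have "emeasure lborel (box (L a) (L b)) = ennreal ((Re b - Re a) * (Im b - Im a))"
      by (subst emeasure_lborel_box)
        (auto simp: L_def Basis_vec_def inner_axis forall_2 UNIV_2 axis_eq_axis prod.insert_if)
    then show "emeasure (distr lborel borel V) (box a b) = ennreal (\<Prod>i\<in>Basis. (b - a) \<bullet> i)"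
      using V_meas by (simp add: emeasure_distr V_box BC)
  qed simp
  have linL: "linear L"
    by (rule linearI) (auto simp: L_def vec_eq_iff forall_2)
  have linV: "linear V"
    by (rule linearI) (auto simp: V_def complex_eq_iff)
  have normV: "norm (V v) = norm v" for v
    by (simp add: V_def norm_vec_def L2_set_def sum_2 cmod_def)
  have normL: "norm (L z) = norm z" for z
    using normV[of "L z"] by simp
  \<comment> \<open>Rotation by \<open>-\<theta>\<close>: the preimage of a box under the rotation
    by \<open>\<theta>\<close> is the image of a box under \<open>Q\<close>.\<close>
  define Q where "Q v = L (cis (-\<theta>) * V v)" for v
  have orth: "orthogonal_transformation Q"
    unfolding orthogonal_transformation
  proof (intro conjI)
    have "linear (\<lambda>v. cis (-\<theta>) * V v)"
      using linV by (auto simp: linear_iff algebra_simps)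
    then show "linear Q"
      unfolding Q_def using linL by (auto simp: linear_iff)
    show "\<forall>v. norm (Q v) = norm v"
      by (simp add: Q_def normL normV norm_mult)
  qed
  have pre: "V -` ((\<lambda>w. cis \<theta> * w) -` box l u) = Q ` box (L l) (L u)"
  proof (intro equalityI subsetI)
    fix v assume "v \<in> V -` ((\<lambda>w. cis \<theta> * w) -` box l u)"
    then have "cis \<theta> * V v \<in> box l u" by simp
    then have "L (cis \<theta> * V v) \<in> box (L l) (L u)" by (simp flip: V_box)
    moreover have "Q (L (cis \<theta> * V v)) = v"
      by (simp add: Q_def cis_mult flip: mult.assoc)
    ultimately show "v \<in> Q ` box (L l) (L u)" by force
  next
    fix x assume "x \<in> Q ` box (L l) (L u)"
    then obtain v where v: "v \<in> box (L l) (L u)" "x = Q v" by blast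
    from v(1) have "cis \<theta> * V (Q v) \<in> box l u"
      by (simp add: Q_def cis_mult flip: mult.assoc V_box)
    then show "x \<in> V -` ((\<lambda>w. cis \<theta> * w) -` box l u)" using v by simp
  qed
  have m: "(\<lambda>w. cis \<theta> * w) \<in> borel_measurable borel" by simp
  \<comment> \<open>Invariance under \<open>Q\<close> concerns the completed measure
    \<open>lebesgue\<close>; Borel measurability of the image leads from \<open>lborel\<close> to
    it.\<close>
  have mQ: "Q ` box (L l) (L u) \<in> sets borel"
    unfolding pre[symmetric] by (intro measurable_sets_borel[OF V_meas] measurable_sets_borel[OF m]) simp
  have bl: "box (L l) (L u) \<in> lmeasurable" by simp
  have "emeasure (distr lborel borel (\<lambda>w. cis \<theta> * w)) (box l u) =
      emeasure (distr lborel borel V) ((\<lambda>w. cis \<theta> * w) -` box l u)"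
    unfolding dV by (simp add: emeasure_distr)
  also have "\<dots> = emeasure lborel (Q ` box (L l) (L u))"
    using V_meas m by (subst emeasure_distr) (auto simp: pre intro!: measurable_sets_borel[OF m])
  also have "\<dots> = emeasure lebesgue (Q ` box (L l) (L u))"
    using mQ by simp
  also have "\<dots> = ennreal (measure lebesgue (Q ` box (L l) (L u)))"
    using measurable_orthogonal_image[OF orth bl] by (simp add: emeasure_eq_measure2)
  also have "\<dots> = ennreal (measure lebesgue (box (L l) (L u)))"
    by (simp only: measure_orthogonal_image[OF orth bl])
  also have "\<dots> = emeasure lborel (box (L l) (L u))"
    using emeasure_lborel_box_finite[of "L l" "L u"]
    by (simp add: emeasure_eq_ennreal_measure less_top)
  also have "\<dots> = emeasure (distr lborel borel V) (box l u)"
    using V_meas by (simp add: emeasure_distr V_box)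
  also have "\<dots> = ennreal (\<Prod>i\<in>Basis. (u - l) \<bullet> i)"
    unfolding dV using lu by (simp add: emeasure_lborel_box)
  finally show "emeasure (distr lborel borel (\<lambda>w. cis \<theta> * w)) (box l u) = 
     ennreal (\<Prod>i\<in>Basis. (u - l) \<bullet> i)" .
qed simp

text \<open>Cauchy's formula on the unit circle for the map taking \<open>u\<close> to
  \<open>f (u * w)\<close>. Scaling by \<open>w\<close> keeps the parameter interval fixed while the
  radius \<open>cmod w\<close> varies.\<close>

lemma norm_le_circle_average:
  fixes f :: "complex \<Rightarrow> complex"
  assumes f: "f holomorphic_on ball 0 \<rho>" and w: "w \<in> ball 0 \<rho>"
  shows "ennreal (norm (f 0)) \<le> (\<integral>\<^sup>+x\<in>{0..1}. ennreal (norm (f (cis (2 * pi * x) * w))) \<partial>lborel)"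
proof -
  have sub: "(\<lambda>u. u * w) ` cball 0 1 \<subseteq> ball 0 \<rho>"
  proof safe
    fix u :: complex assume "u \<in> cball 0 1"
    then have "norm (u * w) \<le> norm w" by (simp add: norm_mult mult_left_le_one_le)
    then show "u * w \<in> ball 0 \<rho>" using w by simp
  qed
  define g where "g u = f (u * w)" for u
  have g: "g holomorphic_on cball 0 1"
    unfolding g_def
    by (rule holomorphic_on_compose_gen[OF _ f, unfolded o_def]) (use sub in \<open>auto intro!: holomorphic_intros\<close>)
  have "((\<lambda>u. g u / (u - 0)) has_contour_integral (2 * of_real pi * \<i> * g 0)) (circlepath 0 1)"
    by (rule Cauchy_integral_circlepath_simple[OF g]) simp
  then have "((\<lambda>x. (2 * of_real pi * \<i>) * g (cis (2 * pi * x))) has_integral (2 * of_real pi * \<i> * g 0)) {0..1}"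
    unfolding has_contour_integral_def
    by (rule has_integral_eq[rotated])
      (simp add: vector_derivative_circlepath01, simp add: circlepath cis_conv_exp mult_ac)
  then have "((\<lambda>x. g (cis (2 * pi * x))) has_integral g 0) {0..1}"
    by (simp add: has_integral_mult_right_iff)
  moreover have gc: "continuous_on {0..1} (\<lambda>x. g (cis (2 * pi * x)))"
    by (rule continuous_on_compose2[OF holomorphic_on_imp_continuous_on[OF g]])
      (auto intro!: continuous_intros)
  ultimately have "norm (g 0) \<le> integral {0..1} (\<lambda>x. norm (g (cis (2 * pi * x))))"
    by (metis integral_norm_bound_integral integrable_continuous_real continuous_on_norm
         integral_unique order_refl)
  then have "ennreal (norm (g 0)) \<le> ennreal (integral {0..1} (\<lambda>x. norm (g (cis (2 * pi * x)))))"
    by (rule ennreal_leI)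
  also have "ennreal (integral {0..1} (\<lambda>x. norm (g (cis (2 * pi * x))))) =
      (\<integral>\<^sup>+x\<in>{0..1}. ennreal (norm (g (cis (2 * pi * x)))) \<partial>lborel)"
    by (rule nn_integral_has_integral_lebesgue'[symmetric])
      (auto intro!: integrable_integral integrable_continuous_real continuous_on_norm gc)
  finally have "ennreal (norm (g 0)) \<le> (\<integral>\<^sup>+x\<in>{0..1}. ennreal (norm (g (cis (2 * pi * x)))) \<partial>lborel)" .
  then show ?thesis unfolding g_def by simp
qed

text \<open>The circle averages are integrated over \<open>w\<close> in the ball and the two
  integrals exchanged; by rotation invariance the integral over \<open>w\<close> does not depend on
  the angle. This takes the place of polar coordinates.\<close>

lemma submean_value_ball_zero:
  fixes f :: "complex \<Rightarrow> complex"
  assumes f: "f holomorphic_on ball 0 \<rho>"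
  shows "ennreal (norm (f 0)) * emeasure lborel (ball (0::complex) \<rho>)
    \<le> (\<integral>\<^sup>+w\<in>ball 0 \<rho>. ennreal (norm (f w)) \<partial>lborel)"
proof -
  \<comment> \<open>Extension by zero, so that rotations act on an integral over the whole
    plane.\<close>
  define F where "F w = ennreal (norm (f w)) * indicator (ball 0 \<rho>) w" for w
  have "(\<lambda>w. indicator (ball 0 \<rho>) w *\<^sub>R norm (f w)) \<in> borel_measurable borel"
    using holomorphic_on_imp_continuous_on[OF f]
    by (intro borel_measurable_continuous_on_indicator continuous_on_norm) auto
  then have "(\<lambda>w. ennreal (indicator (ball 0 \<rho>) w *\<^sub>R norm (f w))) \<in> borel_measurable borel"
    by simp
  also have "(\<lambda>w. ennreal (indicator (ball 0 \<rho>) w *\<^sub>R norm (f w))) = F"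
    by (auto simp: F_def fun_eq_iff indicator_def)
  finally have F [measurable]: "F \<in> borel_measurable borel" .
  have rot: "(\<integral>\<^sup>+w. F (cis \<theta> * w) \<partial>lborel) = (\<integral>\<^sup>+w. F w \<partial>lborel)" for \<theta>
    by (subst (2) distr_rotation_lborel[of \<theta>, symmetric]) (simp add: nn_integral_distr)
  have cis_meas [measurable]: "(\<lambda>x. cis (2 * pi * x)) \<in> borel_measurable borel"
    by (intro borel_measurable_continuous_onI continuous_intros)
  have "ennreal (norm (f 0)) * emeasure lborel (ball (0::complex) \<rho>) =
      (\<integral>\<^sup>+w. ennreal (norm (f 0)) * indicator (ball (0::complex) \<rho>) w \<partial>lborel)"
    by (simp add: nn_integral_cmult_indicator)
  also have "\<dots> \<le> (\<integral>\<^sup>+w. (\<integral>\<^sup>+x\<in>{0..1}. F (cis (2 * pi * x) * w) \<partial>lborel) \<partial>lborel)"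
  proof (intro nn_integral_mono)
    fix w :: complex
    show "ennreal (norm (f 0)) * indicator (ball 0 \<rho>) w \<le> (\<integral>\<^sup>+x\<in>{0..1}. F (cis (2 * pi * x) * w) \<partial>lborel)"
      using norm_le_circle_average[OF f, of w]
      by (cases "w \<in> ball 0 \<rho>") (auto simp: F_def indicator_def norm_mult)
  qed
  also have "\<dots> = (\<integral>\<^sup>+x. (\<integral>\<^sup>+w. F (cis (2 * pi * x) * w) * indicator {0..1} x \<partial>lborel) \<partial>lborel)"
    by (rule lborel_pair.Fubini') measurable
  also have "\<dots> = (\<integral>\<^sup>+x. (\<integral>\<^sup>+w. F w \<partial>lborel) * indicator {0..1::real} x \<partial>lborel)"
    by (simp add: nn_integral_multc rot)
  also have "\<dots> = (\<integral>\<^sup>+w. F w \<partial>lborel)"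
    by (simp add: nn_integral_cmult_indicator)
  finally show ?thesis by (simp add: F_def)
qed

lemma submean_value_ball:
  fixes f :: "complex \<Rightarrow> complex"
  assumes f: "f holomorphic_on ball a \<rho>"
  shows "ennreal (norm (f a)) * emeasure lborel (ball a \<rho>)
    \<le> (\<integral>\<^sup>+w\<in>ball a \<rho>. ennreal (norm (f w)) \<partial>lborel)"
proof -
  have eq: "indicator (ball a \<rho>) (a + w) = (indicator (ball 0 \<rho>) w :: ennreal)" for w :: complex
    by (auto simp: indicator_def dist_norm)
  have f0: "(\<lambda>w. f (a + w)) holomorphic_on ball 0 \<rho>"
    by (rule holomorphic_on_compose_gen[OF _ f, unfolded o_def])
      (auto intro!: holomorphic_intros simp: dist_norm)
  have meas: "(\<lambda>w. ennreal (norm (f w)) * indicator (ball a \<rho>) w) \<in> borel_measurable borel"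
  proof -
    have "(\<lambda>w. ennreal (indicator (ball a \<rho>) w *\<^sub>R norm (f w))) \<in> borel_measurable borel"
      using holomorphic_on_imp_continuous_on[OF f]
      by (intro measurable_compose[OF _ measurable_ennreal] borel_measurable_continuous_on_indicator continuous_on_norm) auto
    then show ?thesis
      by (rule back_subst[of "\<lambda>g. g \<in> borel_measurable borel"]) (auto simp: fun_eq_iff indicator_def)
  qed
  have "emeasure lborel (ball a \<rho>) = emeasure lborel (ball (0::complex) \<rho>)"
    by (cases "\<rho> \<ge> 0") (simp_all add: emeasure_ball ball_empty)
  moreover have "(\<integral>\<^sup>+w\<in>ball a \<rho>. ennreal (norm (f w)) \<partial>lborel) = (\<integral>\<^sup>+w\<in>ball 0 \<rho>. ennreal (norm (f (a + w))) \<partial>lborel)"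
    using meas by (subst lborel_distr_plus[symmetric, of a]) (simp add: nn_integral_distr eq)
  ultimately show ?thesis using submean_value_ball_zero[OF f0] by simp
qed

subsection \<open>The weighted space and the closure of the multiples of the atomic inner function\<close>

text \<open>Taylor polynomials at 0 suffice: the power series converges at a point
  \<open>\<rho>\<close> beyond 1, hence uniformly on the closed unit disc.\<close>

lemma polynomial_approx_on_disc:
  assumes h: "h holomorphic_on ball 0 R" and R: "1 < R" and e: "0 < (e::real)"
  obtains q where "\<And>z. z \<in> cball 0 1 \<Longrightarrow> cmod (poly q z - h z) < e"
proof -
  define a where "a n = (deriv ^^ n) h 0 / fact n" for n
  have sums: "(\<lambda>n. a n * z ^ n) sums h z" if "z \<in> ball 0 R" for z
    using holomorphic_power_series[OF h that] by (simp add: a_def)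
  define \<rho> where "\<rho> = (1 + R) / 2"
  have \<rho>: "1 < \<rho>" "\<rho> < R" using R by (auto simp: \<rho>_def)
  have "summable (\<lambda>n. a n * (of_real \<rho>) ^ n)"
    using sums[of "of_real \<rho>"] \<rho> by (auto intro: sums_summable)
  then have "ereal (norm (of_real \<rho> :: complex)) \<le> conv_radius a"
    by (rule conv_radius_geI)
  then have "1 < conv_radius a"
    using \<rho> by (simp add: one_ereal_def) (meson ereal_less_eq(3) less_le_trans less_ereal.simps(1))
  then have "uniform_limit (cball 0 1) (\<lambda>n x. \<Sum>i<n. a i * (x - 0) ^ i) (\<lambda>x. \<Sum>i. a i * (x - 0) ^ i) sequentially"
    by (intro powser_uniform_limit) (simp add: one_ereal_def)
  then obtain n where n: "\<And>x. x \<in> cball 0 1 \<Longrightarrow> dist (\<Sum>i<n. a i * x ^ i) (\<Sum>i. a i * x ^ i) < e"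
    using e unfolding uniform_limit_iff eventually_sequentially diff_zero by (metis order_refl)
  define q where "q = (\<Sum>i<n. monom (a i) i)"
  show ?thesis
  proof (rule that)
    fix z :: complex assume z: "z \<in> cball 0 1"
    then have "(\<Sum>i. a i * z ^ i) = h z" using R sums[of z] by (auto simp: sums_iff)
    then show "cmod (poly q z - h z) < e"
      using n[OF z] by (simp add: q_def poly_sum poly_monom dist_norm)
  qed
qed

text \<open>The sum is at most twice the larger summand. The factor \<open>2 powr p\<close> does no
  harm in passing to limits.\<close>

lemma norm_add_powr_le:
  fixes a b :: complex
  assumes "1 \<le> p"
  shows "cmod (a + b) powr p \<le> 2 powr p * (cmod a powr p + cmod b powr p)"
proof -
  define m where "m = max (cmod a) (cmod b)"
  have "cmod (a + b) \<le> 2 * m"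
    using norm_triangle_ineq[of a b] by (auto simp: m_def max_def)
  then have "cmod (a + b) powr p \<le> (2 * m) powr p"
    using assms by (intro powr_mono2) auto
  also have "\<dots> = 2 powr p * m powr p"
    by (rule powr_mult)
  also have "m powr p \<le> cmod a powr p + cmod b powr p"
    by (auto simp: m_def max_def)
  finally show ?thesis by simp
qed

lemma nn_integral_complex_scale:
  fixes F :: "complex \<Rightarrow> ennreal"
  assumes "F \<in> borel_measurable borel" "0 < r"
  shows "(\<integral>\<^sup>+z. F z \<partial>lborel) = ennreal (r\<^sup>2) * (\<integral>\<^sup>+z. F (r *\<^sub>R z) \<partial>lborel)"
  using assms
  by (subst lborel_affine[of r 0])
    (auto simp: nn_integral_density nn_integral_distr nn_integral_cmult)

section \<open>The Cayley transform of the disc onto the right half-plane\<close>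

definition cay :: "complex \<Rightarrow> complex" where "cay z = (1 + z) / (1 - z)"

lemma atomic_inner_cay: "atomic_inner z = exp (- cay z)"
  by (simp add: atomic_inner_def cay_def)

lemma cay_holomorphic: "cay holomorphic_on ball 0 1"
  unfolding cay_def[abs_def] by (intro holomorphic_intros) auto

text \<open>This is the Poisson kernel with pole 1: positive in the disc, zero on the circle away
  from 1.\<close>

lemma Re_cay: "Re (cay z) = (1 - (cmod z)\<^sup>2) / (cmod (1 - z))\<^sup>2"
  unfolding cay_def cmod_power2 by (simp add: Re_divide power2_eq_square algebra_simps)

text \<open>Comes from \<open>cmod (1 + z) \<le> 2\<close>. Where \<open>1 - cmod z\<close> is
  bounded below, the decay of \<open>exp (- \<delta> * cay z)\<close> thus beats powers of
  \<open>cmod (cay z)\<close>.\<close>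

lemma Re_cay_lower:
  assumes z: "cmod z < 1"
  shows "(cmod (cay z))\<^sup>2 * (1 - cmod z) / 4 \<le> Re (cay z)"
proof -
  have "cmod (1 + z) \<le> 2" using norm_triangle_ineq[of 1 z] z by simp
  then have "(cmod (1 + z))\<^sup>2 \<le> 2\<^sup>2" by (intro power_mono) auto
  then have "(cmod (1 + z))\<^sup>2 * (1 - cmod z) \<le> 4 * (1 - cmod z)"
    using z by (intro mult_right_mono) auto
  also have "\<dots> \<le> 4 * (1 - (cmod z)\<^sup>2)"
    using z by (simp add: power2_eq_square mult_left_le_one_le)
  finally have "(cmod (1 + z))\<^sup>2 * (1 - cmod z) / 4 / (cmod (1 - z))\<^sup>2 \<le> (1 - (cmod z)\<^sup>2) / (cmod (1 - z))\<^sup>2"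
    by (intro divide_right_mono) auto
  moreover have "(cmod (cay z))\<^sup>2 * (1 - cmod z) / 4 = (cmod (1 + z))\<^sup>2 * (1 - cmod z) / 4 / (cmod (1 - z))\<^sup>2"
    by (simp add: cay_def norm_divide power_divide)
  ultimately show ?thesis by (simp only: Re_cay)
qed

lemma Re_cay_pos: "cmod z < 1 \<Longrightarrow> 0 \<le> Re (cay z)"
  by (rule order_trans[OF _ Re_cay_lower]) auto

lemma atomic_inner_holomorphic: "atomic_inner holomorphic_on ball 0 1"
  unfolding atomic_inner_def[abs_def]
  by (intro holomorphic_intros) (auto simp: dist_norm)

lemma poly_inner_holomorphic: "(\<lambda>z. poly q z * atomic_inner z) holomorphic_on ball 0 1"
  by (intro holomorphic_intros atomic_inner_holomorphic)

lemma norm_atomic_inner_le: "cmod z < 1 \<Longrightarrow> cmod (atomic_inner z) \<le> 1"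
  using Re_cay_pos[of z] by (simp add: atomic_inner_cay)

lemma tendsto_dilation:
  assumes f: "f holomorphic_on ball 0 1" and r: "r \<longlonglongrightarrow> 1" and z: "z \<in> ball 0 1"
  shows "(\<lambda>n. f (complex_of_real (r n) * z)) \<longlonglongrightarrow> f z"
proof -
  have "isCont f z"
    using f z by (metis continuous_on_eq_continuous_at holomorphic_on_imp_continuous_on open_ball)
  moreover have "(\<lambda>n. complex_of_real (r n) * z) \<longlonglongrightarrow> of_real 1 * z"
    by (intro tendsto_intros r)
  ultimately show ?thesis
    by (intro isCont_tendsto_compose[of z f]) auto
qed

lemma holomorphic_dilation:
  assumes f: "f holomorphic_on ball 0 1" and r: "0 < r" 
  shows "(\<lambda>z. f (complex_of_real r * z)) holomorphic_on ball 0 (1 / r)"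
  by (rule holomorphic_on_compose_gen[OF _ f, unfolded o_def])
    (use r in \<open>auto intro!: holomorphic_intros simp: norm_mult field_simps\<close>)

lemma holomorphic_dilation_disc:
  assumes f: "f holomorphic_on ball 0 1" and r: "0 < r" "r \<le> 1"
  shows "(\<lambda>z. f (complex_of_real r * z)) holomorphic_on ball 0 1"
  by (rule holomorphic_on_subset[OF holomorphic_dilation[OF f r(1)]])
    (use r in \<open>auto intro!: subset_ball\<close>)

section \<open>The weight and the p-th power of the norm\<close>

locale radial_weight =
  fixes p :: real and \<Lambda> :: "real \<Rightarrow> real"
  assumes p: "1 \<le> p"
    and pos: "\<And>t. t \<in> {0<..1} \<Longrightarrow> 0 < \<Lambda> t"
    and anti: "antimono_on {0<..1} \<Lambda>"
    and cont: "continuous_on {0<..1} \<Lambda>"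
begin

abbreviation "wi \<equiv> weighted_integral \<Lambda> p"

definition dens :: "(complex \<Rightarrow> complex) \<Rightarrow> complex \<Rightarrow> real" where
  "dens f z = cmod (f z) powr p * exp (- p * \<Lambda> (1 - cmod z))"

lemma wi_dens: "wi f = (\<integral>\<^sup>+z\<in>ball 0 1. ennreal (dens f z) \<partial>lborel)"
  by (simp add: weighted_integral_def dens_def)

lemma dens_nonneg [simp]: "0 \<le> dens f z"
  by (simp add: dens_def)

lemma dens_measurable:
  "f holomorphic_on ball 0 1 \<Longrightarrow>
    (\<lambda>z. ennreal (dens f z) * indicator (ball 0 1) z) \<in> borel_measurable borel"
  using weighted_integrand_measurable[OF p cont, of f] by (simp add: dens_def)

lemma dens_add_le: "dens (\<lambda>z. f z + g z) z \<le> 2 powr p * (dens f z + dens g z)"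
  using mult_right_mono[OF norm_add_powr_le[OF p, of "f z" "g z"], of "exp (- p * \<Lambda> (1 - cmod z))"]
  by (simp add: dens_def algebra_simps)

lemma wi_add_le:
  assumes f: "f holomorphic_on ball 0 1" and g: "g holomorphic_on ball 0 1"
  shows "wi (\<lambda>z. f z + g z) \<le> ennreal (2 powr p) * (wi f + wi g)"
proof -
  have "wi (\<lambda>z. f z + g z) \<le> (\<integral>\<^sup>+z. ennreal (2 powr p) *
      (ennreal (dens f z) * indicator (ball 0 1) z + ennreal (dens g z) * indicator (ball 0 1) z) \<partial>lborel)"
    unfolding wi_dens
  proof (intro nn_integral_mono)
    fix z :: complex
    show "ennreal (dens (\<lambda>z. f z + g z) z) * indicator (ball 0 1) z \<le> ennreal (2 powr p) *
      (ennreal (dens f z) * indicator (ball 0 1) z + ennreal (dens g z) * indicator (ball 0 1) z)"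
      using ennreal_leI[OF dens_add_le[of f g z]]
      by (cases "z \<in> ball 0 1") (auto simp: ennreal_mult' ennreal_plus)
  qed
  also have "\<dots> = ennreal (2 powr p) * (wi f + wi g)"
    using dens_measurable[OF f] dens_measurable[OF g]
    by (simp add: wi_dens nn_integral_cmult nn_integral_add)
  finally show ?thesis .
qed

lemma wi_diff_le:
  assumes "f holomorphic_on ball 0 1" "g holomorphic_on ball 0 1" "h holomorphic_on ball 0 1"
  shows "wi (\<lambda>z. f z - h z) \<le> ennreal (2 powr p) * (wi (\<lambda>z. f z - g z) + wi (\<lambda>z. g z - h z))"
  using wi_add_le[of "\<lambda>z. f z - g z" "\<lambda>z. g z - h z"] assms
  by (simp add: holomorphic_on_diff)

lemma wi_le_sup:
  assumes c: "\<And>z. cmod z < 1 \<Longrightarrow> cmod (f z) * exp (- \<Lambda> (1 - cmod z)) \<le> c"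
  shows "wi f \<le> ennreal (pi * c powr p)"
proof -
  have "wi f \<le> (\<integral>\<^sup>+z. ennreal (c powr p) * indicator (ball (0::complex) 1) z \<partial>lborel)"
    unfolding wi_dens
  proof (intro nn_integral_mono)
    fix z :: complex
    have "dens f z \<le> c powr p" if "cmod z < 1"
    proof -
      have "dens f z = (cmod (f z) * exp (- \<Lambda> (1 - cmod z))) powr p"
        by (simp add: dens_def powr_mult exp_powr_real mult.commute)
      also have "\<dots> \<le> c powr p" using c[OF that] p by (intro powr_mono2) auto
      finally show ?thesis .
    qed
    then show "ennreal (dens f z) * indicator (ball 0 1) z \<le> ennreal (c powr p) * indicator (ball 0 1) z"
      by (auto simp: indicator_def ennreal_leI)
  qed
  also have "\<dots> = ennreal (pi * c powr p)"
    by (simp add: nn_integral_cmult_indicator emeasure_ball unit_ball_vol_2 ennreal_mult'' mult.commute)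
  finally show ?thesis .
qed

lemma weight_le_1: "cmod z < 1 \<Longrightarrow> exp (- \<Lambda> (1 - cmod z)) \<le> 1"
  using pos[of "1 - cmod z"] by simp

lemma wi_le_bound:
  assumes c: "\<And>z. cmod z < 1 \<Longrightarrow> cmod (f z) \<le> c"
  shows "wi f \<le> ennreal (pi * c powr p)"
proof (rule wi_le_sup)
  fix z :: complex assume z: "cmod z < 1"
  have "cmod (f z) * exp (- \<Lambda> (1 - cmod z)) \<le> cmod (f z) * 1"
    using weight_le_1[OF z] by (intro mult_left_mono) auto
  then show "cmod (f z) * exp (- \<Lambda> (1 - cmod z)) \<le> c" using c[OF z] by simp
qed

text \<open>The witness makes \<open>pi * c powr p\<close> equal to \<open>e / 2\<close>. It turns a
  tolerance for the integral into one for the supremum.\<close>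

lemma exists_small_sup:
  assumes "0 < e"
  obtains c where "0 < c" "pi * c powr p < e"
proof -
  show ?thesis
  proof (rule that)
    show "0 < (e / (2 * pi)) powr (1 / p)" "pi * ((e / (2 * pi)) powr (1 / p)) powr p < e"
      using assms p by (simp_all add: powr_powr)
  qed
qed

lemma dens_ennreal_mult_indicator:
  "ennreal (dens f z) * indicator (ball 0 1) z = ennreal (indicator (ball 0 1) z * dens f z)"
  by (simp add: indicator_def)

lemma tendsto_dens_zero:
  assumes "(\<lambda>n. h n z) \<longlonglongrightarrow> 0"
  shows "(\<lambda>n. dens (h n) z) \<longlonglongrightarrow> 0"
proof -
  have "(\<lambda>n. cmod (h n z) powr p) \<longlonglongrightarrow> 0"
    using tendsto_norm_zero[OF assms] p by (intro tendsto_zero_powrI[where b = p]) auto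
  then show ?thesis unfolding dens_def by (rule tendsto_mult_left_zero)
qed

text \<open>Dilation moves points away from the circle, where the weight is at least as large
  because \<Lambda> is non-increasing; the change of variables in the plane costs
  \<open>1 / r\<^sup>2\<close>.\<close>

lemma wi_dilation_le:
  assumes f: "f holomorphic_on ball 0 1" and r: "0 < r" "r < 1"
  shows "wi (\<lambda>z. f (complex_of_real r * z)) \<le> ennreal (1 / r\<^sup>2) * wi f"
proof -
  define F where "F z = ennreal (dens f z) * indicator (ball 0 1) z" for z
  have F: "F \<in> borel_measurable borel"
    unfolding F_def using dens_measurable[OF f] .
  have "wi (\<lambda>z. f (complex_of_real r * z)) \<le> (\<integral>\<^sup>+z. F (r *\<^sub>R z) \<partial>lborel)"
    unfolding wi_dens
  proof (intro nn_integral_mono)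
    fix z :: complex
    have "dens (\<lambda>z. f (complex_of_real r * z)) z \<le> dens f (r *\<^sub>R z) \<and> r *\<^sub>R z \<in> ball 0 1" if z: "z \<in> ball 0 1"
    proof
      have le: "r * cmod z \<le> cmod z" using r by (simp add: mult_left_le_one_le)
      then show "r *\<^sub>R z \<in> ball 0 1" using z r by simp
      have "\<Lambda> (1 - r * cmod z) \<le> \<Lambda> (1 - cmod z)"
        using le z r by (intro monotone_onD[OF anti]) auto
      then show "dens (\<lambda>z. f (complex_of_real r * z)) z \<le> dens f (r *\<^sub>R z)"
        using p r by (auto simp: dens_def norm_mult scaleR_conv_of_real intro!: mult_left_mono)
    qed
    then show "ennreal (dens (\<lambda>z. f (complex_of_real r * z)) z) * indicator (ball 0 1) z \<le> F (r *\<^sub>R z)"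
      by (auto simp: F_def indicator_def intro!: ennreal_leI)
  qed
  also have "\<dots> = ennreal (1 / r\<^sup>2) * (ennreal (r\<^sup>2) * (\<integral>\<^sup>+z. F (r *\<^sub>R z) \<partial>lborel))"
    using r by (simp flip: mult.assoc ennreal_mult)
  also have "ennreal (r\<^sup>2) * (\<integral>\<^sup>+z. F (r *\<^sub>R z) \<partial>lborel) = wi f"
    using nn_integral_complex_scale[OF F r(1)] by (simp add: F_def wi_dens)
  finally show ?thesis .
qed

text \<open>Pointwise convergence together with an upper bound for the norms in the limit gives norm
  convergence. Fatou's lemma bounds the integrals of \<open>u n\<close> below by nearly
  \<open>2 powr p * 2 * I\<close>, while these integrals plus \<open>c n\<close> are bounded above
  by a quantity with the same limit, so \<open>c n\<close> becomes small.\<close>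

lemma dilation_approx:
  assumes f: "f holomorphic_on ball 0 1" "wi f < \<infinity>" and e: "0 < (e::real)"
  obtains r where "0 < r" "r < 1" "wi (\<lambda>z. f (complex_of_real r * z) - f z) < ennreal e"
proof -
  define r where "r n = 1 - 1 / (real n + 2)" for n
  have r: "0 < r n" "r n < 1" for n by (auto simp: r_def field_simps)
  have rlim: "r \<longlonglongrightarrow> 1" unfolding r_def by real_asymp
  define g where "g n z = f (complex_of_real (r n) * z)" for n z
  have g: "g n holomorphic_on ball 0 1" for n
    unfolding g_def using holomorphic_dilation_disc[OF f(1)] r[of n] by simp
  define i where "i z = (indicator (ball 0 1) z :: real)" for z :: complex
  \<comment> \<open>Non-negative by the triangle inequality for p-th powers, and tending to
    \<open>2 powr p * 2\<close> times the density of \<open>f\<close> because the subtracted term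
    vanishes in the limit.\<close>
  define u where "u n z = i z * (2 powr p * (dens (g n) z + dens f z) - dens (\<lambda>z. g n z - f z) z)" for n z
  have u_nonneg: "0 \<le> u n z" for n z
    using dens_add_le[of "g n" "\<lambda>z. - f z" z] by (simp add: u_def i_def dens_def)
  have id_meas: "(\<lambda>z. i z * dens h z) \<in> borel_measurable borel" if "h holomorphic_on ball 0 1" for h
  proof -
    have "(\<lambda>z. enn2real (ennreal (dens h z) * indicator (ball 0 1) z)) \<in> borel_measurable borel"
      using dens_measurable[OF that] by simp
    then show ?thesis by (simp add: dens_ennreal_mult_indicator i_def)
  qed
  have u_meas: "u n \<in> borel_measurable borel" for n
  proof -
    have "u n = (\<lambda>z. 2 powr p * (i z * dens (g n) z + i z * dens f z) - i z * dens (\<lambda>z. g n z - f z) z)"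
      by (auto simp: u_def fun_eq_iff algebra_simps)
    then show ?thesis
      using id_meas[OF g[of n]] id_meas[OF f(1)] id_meas[OF holomorphic_on_diff[OF g[of n] f(1)]]
      by simp
  qed
  define I where "I = enn2real (wi f)"
  have I: "wi f = ennreal I" "0 \<le> I" using f(2) by (auto simp: I_def)
  define c where "c n = wi (\<lambda>z. g n z - f z)" for n
  have sum_le: "(\<integral>\<^sup>+z. u n z \<partial>lborel) + c n \<le> ennreal (2 powr p * (1 / (r n)\<^sup>2 + 1) * I)" for n
  proof -
    have "(\<integral>\<^sup>+z. u n z \<partial>lborel) + c n = (\<integral>\<^sup>+z. ennreal (u n z) + ennreal (i z * dens (\<lambda>z. g n z - f z) z) \<partial>lborel)"
      using u_meas[of n] id_meas[OF holomorphic_on_diff[OF g[of n] f(1)]]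
      by (simp add: nn_integral_add c_def wi_dens dens_ennreal_mult_indicator i_def)
    also have "\<dots> = (\<integral>\<^sup>+z. ennreal (2 powr p) * (ennreal (i z * dens (g n) z) + ennreal (i z * dens f z)) \<partial>lborel)"
      using u_nonneg[of n]
      by (intro nn_integral_cong)
        (simp add: u_def i_def algebra_simps flip: ennreal_plus ennreal_mult)
    also have "\<dots> = ennreal (2 powr p) * (wi (g n) + wi f)"
      using id_meas[OF g[of n]] id_meas[OF f(1)]
      by (simp add: nn_integral_add nn_integral_cmult wi_dens dens_ennreal_mult_indicator i_def)
    also have "\<dots> \<le> ennreal (2 powr p) * (ennreal (1 / (r n)\<^sup>2) * wi f + wi f)"
      using wi_dilation_le[OF f(1) r] unfolding g_def by (intro mult_left_mono add_right_mono) auto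
    also have "\<dots> = ennreal (2 powr p * (1 / (r n)\<^sup>2 + 1) * I)"
      using I by (simp add: algebra_simps flip: ennreal_plus ennreal_mult)
    finally show ?thesis .
  qed
  have "ennreal (2 powr p * 2 * I) = (\<integral>\<^sup>+z. ennreal (2 powr p * 2) * ennreal (i z * dens f z) \<partial>lborel)"
  proof -
    have "(\<integral>\<^sup>+z. ennreal (2 powr p * 2) * ennreal (i z * dens f z) \<partial>lborel) = ennreal (2 powr p * 2) * wi f"
      unfolding wi_dens dens_ennreal_mult_indicator i_def[symmetric]
      using id_meas[OF f(1)] by (intro nn_integral_cmult) simp
    then show ?thesis using I by (simp add: ennreal_mult)
  qed
  also have "\<dots> = (\<integral>\<^sup>+z. liminf (\<lambda>n. ennreal (u n z)) \<partial>lborel)"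
  proof (intro nn_integral_cong)
    fix z :: complex
    have "(\<lambda>n. u n z) \<longlonglongrightarrow> i z * (2 powr p * (dens f z + dens f z) - 0)" if "z \<in> ball 0 1"
    proof -
      have gz: "(\<lambda>n. g n z) \<longlonglongrightarrow> f z"
        unfolding g_def by (rule tendsto_dilation[OF f(1) rlim that])
      have "(\<lambda>n. dens (\<lambda>z. g n z - f z) z) \<longlonglongrightarrow> 0"
        using gz by (intro tendsto_dens_zero) (simp add: LIM_zero)
      moreover have "(\<lambda>n. dens (g n) z) \<longlonglongrightarrow> dens f z"
        unfolding dens_def using gz p by (intro tendsto_intros tendsto_powr') auto
      ultimately show ?thesis unfolding u_def by (intro tendsto_intros)
    qed
    then have "(\<lambda>n. ennreal (u n z)) \<longlonglongrightarrow> ennreal (2 powr p * 2) * ennreal (i z * dens f z)"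
      by (cases "z \<in> ball 0 1")
        (auto simp: u_def i_def mult_ac simp flip: ennreal_mult dest!: tendsto_ennrealI)
    then show "ennreal (2 powr p * 2) * ennreal (i z * dens f z) = liminf (\<lambda>n. ennreal (u n z))"
      by (simp add: lim_imp_Liminf)
  qed
  also have "\<dots> \<le> liminf (\<lambda>n. \<integral>\<^sup>+z. u n z \<partial>lborel)"
    using u_meas by (intro nn_integral_liminf) simp
  finally have low: "ennreal (2 powr p * 2 * I) \<le> liminf (\<lambda>n. \<integral>\<^sup>+z. u n z \<partial>lborel)" .
  have "(\<lambda>n. 2 powr p * (1 / (r n)\<^sup>2 + 1) * I) \<longlonglongrightarrow> 2 powr p * (1 / 1\<^sup>2 + 1) * I"
    by (intro tendsto_intros rlim) auto
  then have "eventually (\<lambda>n. 2 powr p * (1 / (r n)\<^sup>2 + 1) * I < 2 powr p * 2 * I + e / 2) sequentially"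
    using e by (intro order_tendstoD(2)) auto
  \<comment> \<open>The left side may be negative before the embedding; \<open>ennreal\<close> then
    sends it to 0 and the bound is trivial.\<close>
  moreover have "eventually (\<lambda>n. ennreal (2 powr p * 2 * I - e / 2) \<le> (\<integral>\<^sup>+z. u n z \<partial>lborel)) sequentially"
  proof (cases "2 powr p * 2 * I - e / 2 \<le> 0")
    case False
    then have "0 < 2 powr p * 2 * I" using e by linarith
    then have "ennreal (2 powr p * 2 * I - e / 2) < ennreal (2 powr p * 2 * I)"
      using e by (intro ennreal_lessI) auto
    from less_LiminfD[OF less_le_trans[OF this low]] show ?thesis
      by (rule eventually_mono) simp
  qed (simp add: ennreal_neg)
  ultimately obtain n where n: "2 powr p * (1 / (r n)\<^sup>2 + 1) * I < 2 powr p * 2 * I + e / 2"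
    "ennreal (2 powr p * 2 * I - e / 2) \<le> (\<integral>\<^sup>+z. u n z \<partial>lborel)"
    using eventually_happens[OF eventually_conj] by force
  have "c n < ennreal e"
  proof -
    have "ennreal (2 powr p * 2 * I - e / 2) + c n \<le> ennreal (2 powr p * (1 / (r n)\<^sup>2 + 1) * I)"
      using sum_le[of n] n(2) by (meson add_right_mono order_trans)
    also have "\<dots> < ennreal (2 powr p * 2 * I + e / 2)"
      using n(1) I e by (intro ennreal_lessI) (auto intro: add_nonneg_pos)
    finally have *: "ennreal (2 powr p * 2 * I - e / 2) + c n < ennreal (2 powr p * 2 * I + e / 2)" .
    then have "c n < \<infinity>" by (auto simp: less_top[symmetric])
    then obtain d where d: "c n = ennreal d" "0 \<le> d" by (cases "c n") auto
    show ?thesis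
    proof (cases "2 powr p * 2 * I - e / 2 \<le> 0")
      case True
      then show ?thesis using * d e by (simp add: ennreal_neg ennreal_less_iff)
    next
      case False
      then show ?thesis using * d e I by (simp add: ennreal_less_iff flip: ennreal_plus)
    qed
  qed
  then show ?thesis using that r unfolding c_def g_def by blast
qed

text \<open>Membership in the closure of the polynomial multiples, measured by the p-th power of the
  norm in \<open>ennreal\<close>: an infinite integral counts as large here, whereas
  \<open>weighted_norm\<close> would send it to 0.\<close>

definition approximable :: "(complex \<Rightarrow> complex) \<Rightarrow> bool" where
  "approximable f \<longleftrightarrow> (\<forall>e>0. \<exists>q. wi (\<lambda>z. poly q z * atomic_inner z - f z) < ennreal e)"

lemma approximable_limit:
  assumes f: "f holomorphic_on ball 0 1"
    and ex: "\<And>e. 0 < e \<Longrightarrow> \<exists>g. g holomorphic_on ball 0 1 \<and> approximable g \<and> wi (\<lambda>z. g z - f z) < ennreal e"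
  shows "approximable f"
  unfolding approximable_def
proof (intro allI impI)
  fix e :: real assume "0 < e"
  \<comment> \<open>The passage through \<open>g\<close> multiplies the sum of the two errors by
    \<open>2 powr p\<close>.\<close>
  define d where "d = e / (2 * 2 powr p)"
  have d: "0 < d" using \<open>0 < e\<close> by (simp add: d_def)
  obtain g where g: "g holomorphic_on ball 0 1" "approximable g" "wi (\<lambda>z. g z - f z) < ennreal d"
    using ex[OF d] by blast
  obtain q where q: "wi (\<lambda>z. poly q z * atomic_inner z - g z) < ennreal d"
    using g(2) d unfolding approximable_def by blast
  have "wi (\<lambda>z. poly q z * atomic_inner z - f z) \<le>
      ennreal (2 powr p) * (wi (\<lambda>z. poly q z * atomic_inner z - g z) + wi (\<lambda>z. g z - f z))"
    by (intro wi_diff_le poly_inner_holomorphic g f)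
  also have "\<dots> < ennreal (2 powr p) * (ennreal d + ennreal d)"
    using q g(3) by (intro ennreal_mult_strict_left_mono add_strict_mono) auto
  also have "\<dots> = ennreal e"
    using d by (simp add: d_def flip: ennreal_plus ennreal_mult)
  finally show "\<exists>q. wi (\<lambda>z. poly q z * atomic_inner z - f z) < ennreal e" by blast
qed

text \<open>Dominated convergence: the weight is at most 1 and the disc has finite area, so the
  constant \<open>B powr p\<close> is an integrable majorant.\<close>

lemma wi_tendsto_zero:
  assumes h: "\<And>n. h n holomorphic_on ball 0 1"
    and B: "\<And>n z. cmod z < 1 \<Longrightarrow> cmod (h n z) \<le> B"
    and lim: "\<And>z. z \<in> ball 0 1 \<Longrightarrow> (\<lambda>n. h n z) \<longlonglongrightarrow> 0"
  shows "(\<lambda>n. wi (h n)) \<longlonglongrightarrow> 0"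
proof -
  have "(\<lambda>n. \<integral>\<^sup>+z. ennreal (dens (h n) z) * indicator (ball 0 1) z \<partial>lborel) \<longlonglongrightarrow>
      integral\<^sup>N lborel (\<lambda>z::complex. 0)"
  proof (rule nn_integral_dominated_convergence[where
        w = "\<lambda>z. ennreal (B powr p) * indicator (ball 0 1) z"])
    show "(\<lambda>z. ennreal (B powr p) * indicator (ball (0::complex) 1) z) \<in> borel_measurable lborel"
      by (intro borel_measurable_times_ennreal borel_measurable_const borel_measurable_indicator) simp
    show "(\<lambda>z::complex. 0::ennreal) \<in> borel_measurable lborel"
      by (rule borel_measurable_const)
    show "(\<lambda>z. ennreal (dens (h n) z) * indicator (ball 0 1) z) \<in> borel_measurable lborel" for n
      using dens_measurable[OF h] by simp
    show "AE z in lborel. ennreal (dens (h n) z) * indicator (ball 0 1) z \<le>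
        ennreal (B powr p) * indicator (ball 0 1) z" for n
    proof (intro AE_I2)
      fix z :: complex
      have "dens (h n) z \<le> B powr p" if z: "cmod z < 1"
      proof -
        have "cmod (h n z) powr p \<le> B powr p"
          using B[OF z] p by (intro powr_mono2) auto
        moreover have "exp (- p * \<Lambda> (1 - cmod z)) \<le> 1"
          using p pos[of "1 - cmod z"] z by simp
        ultimately show ?thesis
          using mult_mono[of "cmod (h n z) powr p" "B powr p" "exp (- p * \<Lambda> (1 - cmod z))" 1]
          by (simp add: dens_def)
      qed
      then show "ennreal (dens (h n) z) * indicator (ball 0 1) z \<le> ennreal (B powr p) * indicator (ball 0 1) z"
        by (auto simp: indicator_def ennreal_leI)
    qed
    show "(\<integral>\<^sup>+z. ennreal (B powr p) * indicator (ball (0::complex) 1) z \<partial>lborel) < \<infinity>"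
      by (simp add: nn_integral_cmult_indicator emeasure_ball ennreal_mult_less_top)
    show "AE z in lborel. (\<lambda>n. ennreal (dens (h n) z) * indicator (ball 0 1) z) \<longlonglongrightarrow> 0"
    proof (intro AE_I2)
      fix z :: complex
      have "(\<lambda>n. ennreal (dens (h n) z)) \<longlonglongrightarrow> ennreal 0" if z: "z \<in> ball 0 1"
        by (intro tendsto_ennrealI tendsto_dens_zero lim z)
      then show "(\<lambda>n. ennreal (dens (h n) z) * indicator (ball 0 1) z) \<longlonglongrightarrow> 0"
        by (cases "z \<in> ball 0 1") auto
    qed
  qed
  then show ?thesis by (simp add: wi_dens)
qed

text \<open>Dilations of \<open>g\<close> are holomorphic beyond the closed disc, hence uniform
  limits of polynomials there. Only \<open>g\<close> is dilated, since the factor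
  \<open>atomic_inner\<close> has to stay intact; boundedness of \<open>g\<close> then lets the
  dilation tend to the identity.\<close>

lemma approximable_bounded_mult:
  assumes g: "g holomorphic_on ball 0 1" and B: "\<And>z. cmod z < 1 \<Longrightarrow> cmod (g z) \<le> B"
  shows "approximable (\<lambda>z. g z * atomic_inner z)"
proof (rule approximable_limit)
  show "(\<lambda>z. g z * atomic_inner z) holomorphic_on ball 0 1"
    by (intro holomorphic_intros g atomic_inner_holomorphic)
  fix e :: real assume e: "0 < e"
  define r where "r n = 1 - 1 / (real n + 2)" for n
  have r: "0 < r n" "r n < 1" for n by (auto simp: r_def field_simps)
  have rlim: "r \<longlonglongrightarrow> 1" unfolding r_def by real_asymp
  define G where "G n z = g (complex_of_real (r n) * z) * atomic_inner z" for n z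
  have G: "G n holomorphic_on ball 0 1" for n
    unfolding G_def using r[of n]
    by (intro holomorphic_intros holomorphic_dilation_disc[OF g] atomic_inner_holomorphic) auto
  define h where "h n z = G n z - g z * atomic_inner z" for n z
  have h: "h n holomorphic_on ball 0 1" for n
    unfolding h_def by (intro holomorphic_intros g atomic_inner_holomorphic G)
  have "(\<lambda>n. wi (h n)) \<longlonglongrightarrow> 0"
  proof (rule wi_tendsto_zero[of h "2 * B", OF h])
    fix n and z :: complex assume z: "cmod z < 1"
    have "cmod (complex_of_real (r n) * z) < 1"
      using z r[of n] mult_left_le_one_le[of "cmod z" "r n"] by (simp add: norm_mult)
    then have "cmod (g (complex_of_real (r n) * z) - g z) \<le> 2 * B"
      using B[OF z] B[of "complex_of_real (r n) * z"] norm_triangle_ineq4[of "g (complex_of_real (r n) * z)" "g z"] by linarith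
    moreover have "cmod (h n z) = cmod (g (complex_of_real (r n) * z) - g z) * cmod (atomic_inner z)"
      by (simp add: h_def G_def left_diff_distrib flip: norm_mult)
    moreover have "\<dots> \<le> cmod (g (complex_of_real (r n) * z) - g z)"
      using norm_atomic_inner_le[OF z] by (simp add: mult_left_le)
    ultimately show "cmod (h n z) \<le> 2 * B" by linarith
  next
    fix z :: complex assume z: "z \<in> ball 0 1"
    have "(\<lambda>n. g (complex_of_real (r n) * z)) \<longlonglongrightarrow> g z"
      by (rule tendsto_dilation[OF g rlim z])
    then have "(\<lambda>n. G n z) \<longlonglongrightarrow> g z * atomic_inner z"
      unfolding G_def by (intro tendsto_intros)
    then show "(\<lambda>n. h n z) \<longlonglongrightarrow> 0" unfolding h_def by (simp add: LIM_zero)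
  qed
  then have "eventually (\<lambda>n. wi (h n) < ennreal e) sequentially"
    using e by (intro order_tendstoD(2)) auto
  then obtain n where n: "wi (h n) < ennreal e"
    using eventually_happens sequentially_bot by blast
  have "approximable (G n)"
    unfolding approximable_def
  proof (intro allI impI)
    fix d :: real assume "0 < d"
    then obtain c where c: "0 < c" "pi * c powr p < d" by (rule exists_small_sup)
    obtain q where q: "\<And>z. z \<in> cball 0 1 \<Longrightarrow> cmod (poly q z - g (complex_of_real (r n) * z)) < c"
      using polynomial_approx_on_disc[OF holomorphic_dilation[OF g r(1)[of n]], of c] r[of n] c by (auto simp: field_simps)
    have "wi (\<lambda>z. poly q z * atomic_inner z - G n z) \<le> ennreal (pi * c powr p)"
    proof (rule wi_le_bound)
      fix z :: complex assume z: "cmod z < 1"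
      have "cmod (poly q z * atomic_inner z - G n z) = cmod (poly q z - g (complex_of_real (r n) * z)) * cmod (atomic_inner z)"
        by (simp add: G_def left_diff_distrib flip: norm_mult)
      also have "\<dots> \<le> c * 1"
        using q[of z] z c(1) norm_atomic_inner_le[OF z] by (intro mult_mono) auto
      finally show "cmod (poly q z * atomic_inner z - G n z) \<le> c" by simp
    qed
    also have "\<dots> < ennreal d" using c \<open>0 < d\<close> by (intro ennreal_lessI) auto
    finally show "\<exists>q. wi (\<lambda>z. poly q z * atomic_inner z - G n z) < ennreal d" by blast
  qed
  then show "\<exists>g'. g' holomorphic_on ball 0 1 \<and> approximable g' \<and> wi (\<lambda>z. g' z - g z * atomic_inner z) < ennreal e"
    using G[of n] n by (intro exI[of _ "G n"]) (simp add: h_def[abs_def])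
qed

text \<open>Three steps: multiplying by a bounded polynomial leads from \<open>1\<close> to all
  polynomials, uniform approximation leads to dilations of \<open>f\<close>, and these converge to
  \<open>f\<close> in norm.\<close>

lemma approximable_all:
  assumes one: "approximable (\<lambda>z. 1)" and f: "f holomorphic_on ball 0 1" "wi f < \<infinity>"
  shows "approximable f"
proof -
  have poly: "approximable (poly q)" for q
    unfolding approximable_def
  proof (intro allI impI)
    fix e :: real assume e: "0 < e"
    have "compact (poly q ` cball 0 1)"
      by (intro compact_continuous_image continuous_intros) auto
    then obtain B where B: "\<And>z. z \<in> cball 0 1 \<Longrightarrow> cmod (poly q z) \<le> B"
      using compact_imp_bounded bounded_iff by (metis (no_types, lifting) imageI)
    define M where "M = max B 1"
    have M: "0 < M" "\<And>z. z \<in> cball 0 1 \<Longrightarrow> cmod (poly q z) \<le> M"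
      using B by (force simp: M_def)+
    define d where "d = e / M powr p"
    have d: "0 < d" using e M by (simp add: d_def)
    obtain s where s: "wi (\<lambda>z. poly s z * atomic_inner z - 1) < ennreal d"
      using one d unfolding approximable_def by blast
    have "wi (\<lambda>z. poly (q * s) z * atomic_inner z - poly q z) \<le>
        (\<integral>\<^sup>+z. ennreal (M powr p) * (ennreal (dens (\<lambda>z. poly s z * atomic_inner z - 1) z) * indicator (ball 0 1) z) \<partial>lborel)"
      unfolding wi_dens
    proof (intro nn_integral_mono)
      fix z :: complex
      have "dens (\<lambda>z. poly (q * s) z * atomic_inner z - poly q z) z \<le> M powr p * dens (\<lambda>z. poly s z * atomic_inner z - 1) z"
        if z: "z \<in> ball 0 1"
      proof -
        have "cmod (poly (q * s) z * atomic_inner z - poly q z) = cmod (poly q z) * cmod (poly s z * atomic_inner z - 1)"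
          by (simp add: algebra_simps flip: norm_mult)
        then have "cmod (poly (q * s) z * atomic_inner z - poly q z) powr p = cmod (poly q z) powr p * cmod (poly s z * atomic_inner z - 1) powr p"
          by (simp add: powr_mult)
        also have "\<dots> \<le> M powr p * cmod (poly s z * atomic_inner z - 1) powr p"
          using M(2)[of z] z p by (intro mult_right_mono powr_mono2) auto
        finally show ?thesis by (simp add: dens_def mult_right_mono flip: mult.assoc)
      qed
      then show "ennreal (dens (\<lambda>z. poly (q * s) z * atomic_inner z - poly q z) z) * indicator (ball 0 1) z
          \<le> ennreal (M powr p) * (ennreal (dens (\<lambda>z. poly s z * atomic_inner z - 1) z) * indicator (ball 0 1) z)"
        by (auto simp: indicator_def simp flip: ennreal_mult intro!: ennreal_leI)
    qed
    also have "\<dots> = ennreal (M powr p) * wi (\<lambda>z. poly s z * atomic_inner z - 1)"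
      unfolding wi_dens
      using dens_measurable[OF holomorphic_on_diff[OF poly_inner_holomorphic[of s] holomorphic_on_const[of 1]]]
      by (intro nn_integral_cmult) simp
    also have "\<dots> < ennreal (M powr p) * ennreal d"
      using s M by (intro ennreal_mult_strict_left_mono) auto
    also have "\<dots> = ennreal e" using M e by (simp add: d_def flip: ennreal_mult)
    finally show "\<exists>s. wi (\<lambda>z. poly s z * atomic_inner z - poly q z) < ennreal e" by blast
  qed
  have dil: "approximable (\<lambda>z. f (complex_of_real r * z))" if r: "0 < r" "r < 1" for r
  proof (rule approximable_limit)
    show "(\<lambda>z. f (complex_of_real r * z)) holomorphic_on ball 0 1"
      using holomorphic_dilation_disc[OF f(1)] r by simp
    fix e :: real assume "0 < e"
    then obtain c where c: "0 < c" "pi * c powr p < e" by (rule exists_small_sup)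
    obtain q where q: "\<And>z. z \<in> cball 0 1 \<Longrightarrow> cmod (poly q z - f (complex_of_real r * z)) < c"
      using polynomial_approx_on_disc[OF holomorphic_dilation[OF f(1) r(1)], of c] r c by (auto simp: field_simps)
    have "wi (\<lambda>z. poly q z - f (complex_of_real r * z)) \<le> ennreal (pi * c powr p)"
      using q by (intro wi_le_bound) (auto intro: less_imp_le)
    also have "\<dots> < ennreal e" using c \<open>0 < e\<close> by (intro ennreal_lessI) auto
    finally show "\<exists>g. g holomorphic_on ball 0 1 \<and> approximable g \<and> wi (\<lambda>z. g z - f (complex_of_real r * z)) < ennreal e"
      using poly by (intro exI[of _ "poly q"]) (auto intro!: holomorphic_intros)
  qed
  show ?thesis
  proof (rule approximable_limit[OF f(1)])
    fix e :: real assume "0 < e"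
    then obtain r where r: "0 < r" "r < 1" "wi (\<lambda>z. f (complex_of_real r * z) - f z) < ennreal e"
      using dilation_approx[OF f] by blast
    then show "\<exists>g. g holomorphic_on ball 0 1 \<and> approximable g \<and> wi (\<lambda>z. g z - f z) < ennreal e"
      using dil[OF r(1,2)] holomorphic_dilation_disc[OF f(1), of r] by (intro exI[of _ "\<lambda>z. f (complex_of_real r * z)"]) auto
  qed
qed

section \<open>Cyclicity as approximation of the constant function 1\<close>

lemma atomic_inner_in_space: "atomic_inner \<in> weighted_Bergman \<Lambda> p"
proof -
  have "wi atomic_inner \<le> ennreal (pi * 1 powr p)"
    by (rule wi_le_bound) (rule norm_atomic_inner_le)
  then have "wi atomic_inner < \<infinity>" by (rule order_le_less_trans) simp
  then show ?thesis
    by (simp add: weighted_Bergman_def atomic_inner_holomorphic)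
qed

lemma one_in_space: "(\<lambda>z. 1) \<in> weighted_Bergman \<Lambda> p"
proof -
  have "wi (\<lambda>z. 1) \<le> ennreal (pi * 1 powr p)"
    by (rule wi_le_bound) simp
  then have "wi (\<lambda>z. 1) < \<infinity>" by (rule order_le_less_trans) simp
  then show ?thesis by (simp add: weighted_Bergman_def)
qed

text \<open>Finiteness is essential: an infinite integral would have \<open>weighted_norm\<close>
  equal to 0.\<close>

lemma weighted_norm_less_iff:
  assumes "wi f < \<infinity>" "0 < e"
  shows "weighted_norm \<Lambda> p f < e \<longleftrightarrow> wi f < ennreal (e powr p)"
proof -
  obtain x where x: "wi f = ennreal x" "0 \<le> x" using assms(1) by (cases "wi f") auto
  have "x powr (1 / p) < e \<longleftrightarrow> x < e powr p"
  proof -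
    have "x powr (1 / p) < e \<longleftrightarrow> (x powr (1 / p)) powr p < e powr p"
      using p assms(2) powr_less_mono2[of p "x powr (1 / p)" e] powr_mono2[of p e "x powr (1 / p)"]
      by (auto simp: not_less[symmetric])
    then show ?thesis using p x by (simp add: powr_powr)
  qed
  then show ?thesis using x by (simp add: weighted_norm_def ennreal_less_iff)
qed

text \<open>The constant 1 lies in the space, and by \<open>approximable_all\<close> its
  approximability spreads to every element. The tolerances \<open>e\<close> for the norm and
  \<open>e powr p\<close> for the integral correspond.\<close>

lemma cyclic_iff_approximable_one:
  "cyclic_in (weighted_Bergman \<Lambda> p) (weighted_norm \<Lambda> p) atomic_inner \<longleftrightarrow> approximable (\<lambda>z. 1)"
proof -
  have fin: "wi (\<lambda>z. poly q z * atomic_inner z - f z) < \<infinity>" if "f \<in> weighted_Bergman \<Lambda> p" for q f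
    using weighted_Bergman_diff[OF p cont weighted_Bergman_poly_mult[OF p cont atomic_inner_in_space] that]
    by (simp add: weighted_Bergman_def)
  have iff: "f \<in> norm_closure_in (weighted_Bergman \<Lambda> p) (weighted_norm \<Lambda> p) {(\<lambda>z. poly q z * atomic_inner z) | q. True} \<longleftrightarrow> approximable f"
    if f: "f \<in> weighted_Bergman \<Lambda> p" for f
  proof -
    have "f \<in> norm_closure_in (weighted_Bergman \<Lambda> p) (weighted_norm \<Lambda> p) {(\<lambda>z. poly q z * atomic_inner z) | q. True} \<longleftrightarrow>
      (\<forall>e>0. \<exists>q. weighted_norm \<Lambda> p (\<lambda>z. poly q z * atomic_inner z - f z) < e)"
      using f by (auto simp: norm_closure_in_def)
    also have "\<dots> \<longleftrightarrow> (\<forall>e>0. \<exists>q. wi (\<lambda>z. poly q z * atomic_inner z - f z) < ennreal (e powr p))"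
      using fin[OF f] by (simp add: weighted_norm_less_iff)
    also have "\<dots> \<longleftrightarrow> approximable f"
    proof
      assume L: "\<forall>e>0. \<exists>q. wi (\<lambda>z. poly q z * atomic_inner z - f z) < ennreal (e powr p)"
      show "approximable f" unfolding approximable_def
      proof (intro allI impI)
        fix e :: real assume "0 < e"
        then show "\<exists>q. wi (\<lambda>z. poly q z * atomic_inner z - f z) < ennreal e"
          using L[rule_format, of "e powr (1 / p)"] p by (simp add: powr_powr)
      qed
    qed (auto simp: approximable_def)
    finally show ?thesis .
  qed
  show ?thesis
  proof
    assume "cyclic_in (weighted_Bergman \<Lambda> p) (weighted_norm \<Lambda> p) atomic_inner"
    then show "approximable (\<lambda>z. 1)"
      using one_in_space iff[OF one_in_space] by (simp add: cyclic_in_def)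
  next
    assume "approximable (\<lambda>z. 1)"
    then have "approximable f" if "f \<in> weighted_Bergman \<Lambda> p" for f
      using that approximable_all by (simp add: weighted_Bergman_def)
    then show "cyclic_in (weighted_Bergman \<Lambda> p) (weighted_norm \<Lambda> p) atomic_inner"
      using iff atomic_inner_in_space unfolding cyclic_in_def by (auto simp: norm_closure_in_def)
  qed
qed

end

subsection \<open>Level sets of monotone functions\<close>

text \<open>The set where \<open>L\<close> is at least \<open>y\<close> is an initial segment of the
  interval, and \<open>T\<close> is its end point; whether \<open>T\<close> itself belongs to it is
  left open. Inserting 0 keeps the supremum meaningful when the set is empty.\<close>

lemma antimono_threshold:
  fixes L :: "real \<Rightarrow> real"
  assumes anti: "antimono_on {0<..1} L"
  obtains T where "0 \<le> T" "T \<le> 1" "\<And>t. t \<in> {0<..1} \<Longrightarrow> t < T \<Longrightarrow> y \<le> L t"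
    "\<And>t. t \<in> {0<..1} \<Longrightarrow> y \<le> L t \<Longrightarrow> t \<le> T"
proof -
  define E where "E = insert 0 {t \<in> {0<..1}. y \<le> L t}"
  have bdd: "bdd_above E" by (rule bdd_aboveI[of _ 1]) (auto simp: E_def)
  show ?thesis
  proof (rule that[of "Sup E"])
    show "0 \<le> Sup E" by (rule cSup_upper[OF _ bdd]) (simp add: E_def)
    show "Sup E \<le> 1" by (rule cSup_least) (auto simp: E_def)
    show "t \<le> Sup E" if "t \<in> {0<..1}" "y \<le> L t" for t
      by (rule cSup_upper[OF _ bdd]) (use that in \<open>simp add: E_def\<close>)
    show "y \<le> L t" if t: "t \<in> {0<..1}" "t < Sup E" for t
    proof -
      obtain s where s: "s \<in> E" "t < s" using t(2) by (subst (asm) less_cSup_iff) (auto simp: bdd E_def)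
      then have "s \<in> {0<..1}" "y \<le> L s" using t by (auto simp: E_def)
      moreover have "L s \<le> L t" using s(2) t \<open>s \<in> {0<..1}\<close> by (intro monotone_onD[OF anti]) auto
      ultimately show ?thesis by simp
    qed
  qed
qed

text \<open>Source of the terms \<open>sqrt (T k)\<close>: the factor \<open>1 / sqrt t\<close> of
  the integrand, integrated up to a threshold.\<close>

lemma nn_integral_inverse_sqrt:
  assumes "0 \<le> T"
  shows "(\<integral>\<^sup>+t\<in>{0<..T}. ennreal (1 / sqrt t) \<partial>lborel) = ennreal (2 * sqrt T)"
proof -
  have "((\<lambda>t. 1 / sqrt t) has_integral 2 * sqrt T - 2 * sqrt 0) {0..T}"
  proof (rule fundamental_theorem_of_calculus_interior[OF assms])
    show "continuous_on {0..T} (\<lambda>t. 2 * sqrt t)" by (intro continuous_intros)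
    fix t assume "t \<in> {0<..<T}"
    then show "((\<lambda>t. 2 * sqrt t) has_vector_derivative 1 / sqrt t) (at t)"
      unfolding has_real_derivative_iff_has_vector_derivative[symmetric]
      by (auto intro!: derivative_eq_intros simp: field_simps)
  qed
  moreover have "((\<lambda>t. 1 / sqrt t) has_integral y) {0<..T} \<longleftrightarrow> ((\<lambda>t. 1 / sqrt t) has_integral y) {0..T}" for y
    by (rule has_integral_spike_set_eq) (auto intro: negligible_subset[of "{0}"])
  ultimately have "((\<lambda>t. 1 / sqrt t) has_integral 2 * sqrt T) {0<..T}" by simp
  then show ?thesis
    by (intro nn_integral_has_integral_lebesgue') auto
qed

text \<open>Discretisation at the levels \<open>c * 4 ^ k\<close>, with end points
  \<open>T k\<close> of the superlevel sets. Up to constants, and up to an additive constant in one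
  direction, \<open>sqrt (L t)\<close> is the sum of \<open>2 ^ k\<close> over the levels reached,
  so the integral and the series of \<open>2 ^ k * sqrt (T k)\<close> converge together.\<close>

locale threshold =
  fixes L :: "real \<Rightarrow> real" and c :: real and T :: "nat \<Rightarrow> real"
  assumes c: "0 < c"
    and L_pos: "\<And>t. t \<in> {0<..1} \<Longrightarrow> 0 < L t"
    and T_nonneg: "\<And>k. 0 \<le> T k" and T_le: "\<And>k. T k \<le> 1"
    and T_lower: "\<And>k t. t \<in> {0<..1} \<Longrightarrow> t < T k \<Longrightarrow> c * 4 ^ k \<le> L t"
    and T_upper: "\<And>k t. t \<in> {0<..1} \<Longrightarrow> c * 4 ^ k \<le> L t \<Longrightarrow> t \<le> T k"
begin

lemma sqrt_four_power: "sqrt (4 ^ k) = 2 ^ k"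
  by (simp add: real_sqrt_power)

text \<open>The term of the highest level reached is enough, since \<open>L t\<close> is below four
  times that level; \<open>sqrt c\<close> covers the case that no level is reached.\<close>

lemma sqrt_le_sum:
  assumes t: "t \<in> {0<..1}"
  shows "\<exists>N. sqrt (L t) \<le> sqrt c + (\<Sum>k<N. 2 * sqrt c * 2 ^ k * indicator {0<..T k} t)"
proof (cases "L t < c")
  case True
  then show ?thesis by (intro exI[of _ 0]) simp
next
  case False
  obtain m where m: "L t < c * 4 ^ m"
    using real_arch_pow[of 4 "L t / c"] c by (auto simp: field_simps)
  \<comment> \<open>The first level above \<open>L t\<close>; its predecessor is the highest level
    reached.\<close>
  define n where "n = (LEAST m. L t < c * 4 ^ m)"
  have n: "L t < c * 4 ^ n" unfolding n_def by (rule LeastI[of _ m]) (rule m)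
  have "n \<noteq> 0" using False n by (cases n) auto
  then obtain k where k: "n = Suc k" by (cases n) auto
  have "c * 4 ^ k \<le> L t"
    using not_less_Least[of k "\<lambda>m. L t < c * 4 ^ m"] k by (simp add: n_def not_less)
  then have tk: "t \<le> T k" using T_upper[OF t] by simp
  have "sqrt (L t) \<le> sqrt (c * 4 ^ Suc k)" using n k by (intro real_sqrt_le_mono) simp
  also have "\<dots> = 2 * sqrt c * 2 ^ k" by (simp only: real_sqrt_mult sqrt_four_power) simp
  also have "\<dots> = 2 * sqrt c * 2 ^ k * indicator {0<..T k} t"
    using tk t by simp
  also have "\<dots> \<le> (\<Sum>k<Suc k. 2 * sqrt c * 2 ^ k * indicator {0<..T k} t)"
    using c by (intro member_le_sum) auto
  finally have "sqrt (L t) \<le> sqrt c + (\<Sum>k<Suc k. 2 * sqrt c * 2 ^ k * indicator {0<..T k} t)"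
    using c by (simp add: add_increasing)
  then show ?thesis by blast
qed

text \<open>The bound of \<open>sqrt_le_sum\<close> is multiplied by \<open>1 / sqrt t\<close> and
  integrated term by term.\<close>

lemma summable_imp_finite_integral:
  assumes sm: "summable (\<lambda>k. 2 ^ k * sqrt (T k))"
  shows "(\<integral>\<^sup>+t\<in>{0<..1}. ennreal (sqrt (L t / t)) \<partial>lborel) < \<infinity>"
proof -
  define F where "F a t = ennreal (1 / sqrt t) * indicator {0<..a} t" for a t :: real
  have F: "F a \<in> borel_measurable lborel" for a
    unfolding F_def by measurable
  have intF: "(\<integral>\<^sup>+t. F a t \<partial>lborel) = ennreal (2 * sqrt a)" if "0 \<le> a" for a
    unfolding F_def using nn_integral_inverse_sqrt[OF that] .
  have "(\<integral>\<^sup>+t\<in>{0<..1}. ennreal (sqrt (L t / t)) \<partial>lborel) \<le>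
    (\<integral>\<^sup>+t. ennreal (sqrt c) * F 1 t + (\<Sum>k. ennreal (2 * sqrt c * 2 ^ k) * F (T k) t) \<partial>lborel)"
  proof (intro nn_integral_mono)
    fix t :: real
    show "ennreal (sqrt (L t / t)) * indicator {0<..1} t \<le>
      ennreal (sqrt c) * F 1 t + (\<Sum>k. ennreal (2 * sqrt c * 2 ^ k) * F (T k) t)"
    proof (cases "t \<in> {0<..1}")
      case t: True
      obtain N where N: "sqrt (L t) \<le> sqrt c + (\<Sum>k<N. 2 * sqrt c * 2 ^ k * indicator {0<..T k} t)"
        using sqrt_le_sum[OF t] by blast
      have "sqrt (L t / t) = sqrt (L t) * (1 / sqrt t)"
        by (simp add: real_sqrt_divide)
      also have "\<dots> \<le> (sqrt c + (\<Sum>k<N. 2 * sqrt c * 2 ^ k * indicator {0<..T k} t)) * (1 / sqrt t)"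
        using N t by (intro mult_right_mono) auto
      also have "\<dots> = sqrt c * (1 / sqrt t) + (\<Sum>k<N. 2 * sqrt c * 2 ^ k * (1 / sqrt t * indicator {0<..T k} t))"
        by (simp add: distrib_right sum_distrib_right sum_divide_distrib add_divide_distrib mult_ac)
      finally have "ennreal (sqrt (L t / t)) \<le> ennreal (sqrt c * (1 / sqrt t)) +
          (\<Sum>k<N. ennreal (2 * sqrt c * 2 ^ k * (1 / sqrt t * indicator {0<..T k} t)))"
        using c t by (subst sum_ennreal, simp, subst ennreal_plus[symmetric]) (auto intro!: ennreal_leI sum_nonneg)
      also have "\<dots> = ennreal (sqrt c) * F 1 t + (\<Sum>k<N. ennreal (2 * sqrt c * 2 ^ k) * F (T k) t)"
      proof -
        have "ennreal (2 * sqrt c * 2 ^ k * (1 / sqrt t * indicator {0<..T k} t)) =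
            ennreal (2 * sqrt c * 2 ^ k) * F (T k) t" for k
          using c t by (subst ennreal_mult') (auto simp: F_def indicator_def)
        moreover have "ennreal (sqrt c * (1 / sqrt t)) = ennreal (sqrt c) * F 1 t"
          using c t by (subst ennreal_mult') (auto simp: F_def)
        ultimately show ?thesis by simp
      qed
      also have "\<dots> \<le> ennreal (sqrt c) * F 1 t + (\<Sum>k. ennreal (2 * sqrt c * 2 ^ k) * F (T k) t)"
        by (intro add_left_mono sum_le_suminf) auto
      finally show ?thesis using t by simp
    qed simp
  qed
  also have "\<dots> = ennreal (sqrt c) * ennreal 2 + (\<Sum>k. ennreal (2 * sqrt c * 2 ^ k) * ennreal (2 * sqrt (T k)))"
    using F by (simp add: nn_integral_add nn_integral_suminf nn_integral_cmult intF T_nonneg)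
  also have "(\<Sum>k. ennreal (2 * sqrt c * 2 ^ k) * ennreal (2 * sqrt (T k))) = (\<Sum>k. ennreal (4 * sqrt c * (2 ^ k * sqrt (T k))))"
    using c T_nonneg by (intro suminf_cong) (simp add: mult_ac flip: ennreal_mult)
  also have "\<dots> = ennreal (\<Sum>k. 4 * sqrt c * (2 ^ k * sqrt (T k)))"
    using c T_nonneg sm by (intro suminf_ennreal2) (auto intro!: summable_mult)
  also have "ennreal (sqrt c) * ennreal 2 + \<dots> < \<infinity>"
    by (simp add: ennreal_mult_less_top)
  finally show ?thesis .
qed

text \<open>The sum of \<open>2 ^ k\<close> over the levels reached is geometric, hence dominated by
  its last term and so by \<open>sqrt (L t / c)\<close>. Integration bounds all partial sums of the
  series.\<close>

lemma finite_integral_imp_summable: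
  assumes fin: "(\<integral>\<^sup>+t\<in>{0<..1}. ennreal (sqrt (L t / t)) \<partial>lborel) < \<infinity>"
  shows "summable (\<lambda>k. 2 ^ k * sqrt (T k))"
proof -
  define I where "I = enn2real (\<integral>\<^sup>+t\<in>{0<..1}. ennreal (sqrt (L t / t)) \<partial>lborel)"
  have I: "(\<integral>\<^sup>+t\<in>{0<..1}. ennreal (sqrt (L t / t)) \<partial>lborel) = ennreal I" "0 \<le> I"
    using fin by (auto simp: I_def)
  define F where "F a t = 1 / sqrt t * indicator {0<..a} t" for a t :: real
  have F: "(\<lambda>t. ennreal (F a t)) \<in> borel_measurable lborel" for a
    unfolding F_def by measurable
  have F_nonneg: "0 \<le> F a t" for a t by (simp add: F_def indicator_def)
  have intF: "(\<integral>\<^sup>+t. ennreal (F a t) \<partial>lborel) = ennreal (2 * sqrt a)" if "0 \<le> a" for a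
  proof -
    have "(\<lambda>t. ennreal (F a t)) = (\<lambda>t. ennreal (1 / sqrt t) * indicator {0<..a} t)"
      by (auto simp: F_def fun_eq_iff indicator_def)
    then show ?thesis using nn_integral_inverse_sqrt[OF that] by simp
  qed
  \<comment> \<open>The intervals are open on the right because \<open>T_lower\<close> says nothing
    at \<open>T k\<close> itself.\<close>
  have geo: "(\<Sum>k<N. 2 ^ k * indicator {0<..<T k} t) \<le> 2 * sqrt (L t / c)" if t: "t \<in> {0<..1}" for t N
  proof (induction N)
    case 0
    then show ?case using L_pos[OF t] c by simp
  next
    case (Suc N)
    show ?case
    proof (cases "t < T N")
      case True
      have "(\<Sum>k<Suc N. 2 ^ k * indicator {0<..<T k} t) \<le> (\<Sum>k<Suc N. (2::real) ^ k)"
        by (intro sum_mono) (auto simp: indicator_def)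
      also have "\<dots> = 2 ^ Suc N - 1" by (subst geometric_sum) auto
      also have "\<dots> \<le> 2 * sqrt (4 ^ N)" by (simp add: sqrt_four_power)
      also have "\<dots> \<le> 2 * sqrt (L t / c)"
        using T_lower[OF t True] c by (intro mult_left_mono real_sqrt_le_mono) (auto simp: field_simps)
      finally show ?thesis .
    qed (use Suc in simp)
  qed
  have "(\<Sum>k<N. 2 ^ k * sqrt (T k)) \<le> I / sqrt c" for N
  proof -
    have "ennreal (\<Sum>k<N. sqrt c * (2 ^ k * sqrt (T k))) = (\<Sum>k<N. ennreal (sqrt c / 2 * 2 ^ k) * ennreal (2 * sqrt (T k)))"
    proof -
      have "ennreal (sqrt c / 2 * 2 ^ k) * ennreal (2 * sqrt (T k)) = ennreal (sqrt c * (2 ^ k * sqrt (T k)))" for k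
        using c T_nonneg by (subst ennreal_mult[symmetric]) auto
      then show ?thesis using c T_nonneg by (simp add: sum_ennreal)
    qed
    also have "\<dots> = (\<integral>\<^sup>+t. (\<Sum>k<N. ennreal (sqrt c / 2 * 2 ^ k) * ennreal (F (T k) t)) \<partial>lborel)"
      using F by (simp add: nn_integral_sum nn_integral_cmult intF T_nonneg)
    also have "\<dots> \<le> (\<integral>\<^sup>+t. ennreal (sqrt (L t / t)) * indicator {0<..1} t \<partial>lborel)"
    proof (rule nn_integral_mono_AE)
      \<comment> \<open>The finitely many end points form a null set, which reconciles the open
        intervals of \<open>geo\<close> with the half-open ones of \<open>F\<close>.\<close>
      have "AE t in lborel. t \<notin> T ` {..<N}"
        by (intro AE_not_in finite_imp_null_set_lborel) auto
      then show "AE t in lborel. (\<Sum>k<N. ennreal (sqrt c / 2 * 2 ^ k) * ennreal (F (T k) t)) \<le>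
          ennreal (sqrt (L t / t)) * indicator {0<..1} t"
      proof eventually_elim
        case (elim t)
        show ?case
        proof (cases "t \<in> {0<..1}")
          case t: True
          have "(\<Sum>k<N. sqrt c / 2 * 2 ^ k * F (T k) t) = sqrt c / 2 * (\<Sum>k<N. 2 ^ k * indicator {0<..<T k} t) * (1 / sqrt t)"
            unfolding sum_distrib_right sum_distrib_left
            using elim t by (intro sum.cong) (force simp: F_def indicator_def)+
          also have "\<dots> \<le> sqrt c / 2 * (2 * sqrt (L t / c)) * (1 / sqrt t)"
            using geo[OF t] t c by (intro mult_right_mono mult_left_mono) auto
          also have "\<dots> = sqrt (L t / t)"
            using c by (simp add: real_sqrt_divide)
          finally have "ennreal (\<Sum>k<N. sqrt c / 2 * 2 ^ k * F (T k) t) \<le> ennreal (sqrt (L t / t))"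
            by (rule ennreal_leI)
          moreover have "(\<Sum>k<N. ennreal (sqrt c / 2 * 2 ^ k) * ennreal (F (T k) t)) =
              ennreal (\<Sum>k<N. sqrt c / 2 * 2 ^ k * F (T k) t)"
          proof (subst sum_ennreal[symmetric])
            show "(\<Sum>k<N. ennreal (sqrt c / 2 * 2 ^ k) * ennreal (F (T k) t)) =
                (\<Sum>k<N. ennreal (sqrt c / 2 * 2 ^ k * F (T k) t))"
              using c F_nonneg by (intro sum.cong refl ennreal_mult[symmetric]) auto
          qed (use c F_nonneg in auto)
          ultimately show ?thesis using t by simp
        next
          case False
          then have "F (T k) t = 0" for k using T_le[of k] by (auto simp: F_def indicator_def)
          then show ?thesis by simp
        qed
      qed
    qed
    finally have "ennreal (\<Sum>k<N. sqrt c * (2 ^ k * sqrt (T k))) \<le> ennreal I"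
      unfolding I(1) .
    then have "sqrt c * (\<Sum>k<N. 2 ^ k * sqrt (T k)) \<le> I"
      using I by (subst (asm) ennreal_le_iff) (auto simp: sum_distrib_left)
    then show ?thesis using c by (simp add: field_simps)
  qed
  then show ?thesis
    by (intro summableI_nonneg_bounded) (auto simp: T_nonneg)
qed

end

subsection \<open>Divergence implies cyclicity\<close>

definition binomial_tail :: "nat \<Rightarrow> complex \<Rightarrow> complex" where
  "binomial_tail n s = (\<Sum>k\<le>n. of_nat (2 * n choose k) * (1 - s) ^ k * s ^ (n - k))"

lemma sum_binomial: "(\<Sum>k\<le>N. real (N choose k)) = 2 ^ N"
  using choose_row_sum[of N] by (metis of_nat_sum of_nat_power of_nat_numeral)

lemma norm_one_minus_le: "cmod s \<le> 1 \<Longrightarrow> cmod (1 - s) \<le> 2"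
  using norm_triangle_ineq4[of 1 s] by simp

text \<open>The binomial coefficients contribute \<open>4 ^ n\<close>; at most \<open>n\<close>
  factors \<open>1 - s\<close>, of modulus at most 2, contribute \<open>2 ^ n\<close>.\<close>

lemma norm_binomial_tail_le:
  assumes s: "cmod s \<le> 1"
  shows "cmod (binomial_tail n s) \<le> 8 ^ n"
proof -
  have "cmod (binomial_tail n s) \<le> (\<Sum>k\<le>n. real (2 * n choose k) * 2 ^ n)"
    unfolding binomial_tail_def
  proof (rule sum_norm_le)
    fix k assume k: "k \<in> {..n}"
    have "cmod (1 - s) ^ k * cmod s ^ (n - k) \<le> 2 ^ k * 1"
      using norm_one_minus_le[OF s] s by (intro mult_mono power_mono power_le_one) auto
    also have "\<dots> \<le> 2 ^ n" using k by (simp add: power_increasing)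
    finally show "cmod (of_nat (2 * n choose k) * (1 - s) ^ k * s ^ (n - k)) \<le> real (2 * n choose k) * 2 ^ n"
      by (simp add: norm_mult norm_power mult.assoc mult_left_mono)
  qed
  also have "\<dots> \<le> (\<Sum>k\<le>2 * n. real (2 * n choose k) * 2 ^ n)"
    by (intro sum_mono2) auto
  also have "\<dots> = 8 ^ n"
    by (simp add: sum_binomial power_mult flip: sum_distrib_right power_mult_distrib)
  finally show ?thesis .
qed

text \<open>In the expansion of \<open>((1 - s) + s) ^ (2 * n)\<close> the terms with at most
  \<open>n\<close> factors \<open>1 - s\<close> are divisible by \<open>s ^ n\<close> and form
  \<open>s ^ n * binomial_tail n s\<close>. Every other term has more than \<open>n\<close> small
  factors.\<close>

lemma norm_one_minus_binomial_tail_le: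
  assumes s: "cmod s \<le> 1"
  shows "cmod (1 - s ^ n * binomial_tail n s) \<le> (8 * cmod (1 - s)) ^ n"
proof -
  define b where "b k = of_nat (2 * n choose k) * (1 - s) ^ k * s ^ (2 * n - k)" for k
  have "1 = ((1 - s) + s) ^ (2 * n)" by simp
  also have "\<dots> = (\<Sum>k\<le>2 * n. b k)"
    unfolding b_def by (rule binomial_ring)
  also have "{..2 * n} = {..n} \<union> {n<..2 * n}" by auto
  also have "sum b \<dots> = sum b {..n} + sum b {n<..2 * n}"
    by (rule sum.union_disjoint) auto
  also have "sum b {..n} = s ^ n * binomial_tail n s"
    unfolding binomial_tail_def sum_distrib_left
  proof (intro sum.cong refl)
    fix k assume "k \<in> {..n}"
    then have "s ^ (2 * n - k) = s ^ n * s ^ (n - k)"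
      by (simp add: mult_2 flip: power_add)
    then show "b k = s ^ n * (of_nat (2 * n choose k) * (1 - s) ^ k * s ^ (n - k))"
      by (simp add: b_def)
  qed
  finally have "cmod (1 - s ^ n * binomial_tail n s) = cmod (sum b {n<..2 * n})"
    by (metis add_diff_cancel_left')
  also have "\<dots> \<le> (\<Sum>k\<in>{n<..2 * n}. real (2 * n choose k) * (2 * cmod (1 - s)) ^ n)"
  proof (rule sum_norm_le)
    fix k assume k: "k \<in> {n<..2 * n}"
    \<comment> \<open>Of the factors \<open>1 - s\<close> only \<open>n\<close> are kept; the other
      \<open>j\<close> are bounded by 2.\<close>
    then obtain j where j: "k = n + j" "j \<le> n" by (auto dest: less_imp_add_positive)
    have "cmod (1 - s) ^ k * cmod s ^ (2 * n - k) \<le> (cmod (1 - s) ^ n * 2 ^ n) * 1"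
    proof (intro mult_mono power_le_one s)
      have "cmod (1 - s) ^ j \<le> 2 ^ j"
        using norm_one_minus_le[OF s] by (intro power_mono) auto
      also have "\<dots> \<le> 2 ^ n" using j by (simp add: power_increasing)
      finally show "cmod (1 - s) ^ k \<le> cmod (1 - s) ^ n * 2 ^ n"
        by (simp add: j power_add mult_left_mono)
    qed auto
    then show "cmod (b k) \<le> real (2 * n choose k) * (2 * cmod (1 - s)) ^ n"
      by (simp add: b_def norm_mult norm_power power_mult_distrib mult.assoc mult_left_mono mult.commute[of "2 ^ n"])
  qed
  also have "\<dots> \<le> (\<Sum>k\<le>2 * n. real (2 * n choose k) * (2 * cmod (1 - s)) ^ n)"
    by (intro sum_mono2) auto
  also have "\<dots> = 2 ^ (2 * n) * (2 * cmod (1 - s)) ^ n"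
    by (simp only: sum_binomial flip: sum_distrib_right)
  also have "\<dots> = (2\<^sup>2 * (2 * cmod (1 - s))) ^ n"
    by (simp only: power_mult power_mult_distrib)
  finally show ?thesis by simp
qed

text \<open>Mean value inequality on the convex right half-plane, where the derivative has modulus
  at most 1.\<close>

lemma norm_one_minus_exp_le:
  assumes "0 \<le> Re w"
  shows "cmod (1 - exp (- w)) \<le> cmod w"
proof -
  have "cmod (exp (- w) - exp (- 0)) \<le> 1 * cmod (w - 0)"
  proof (rule field_differentiable_bound[of "{w. 0 \<le> Re w}" "\<lambda>w. exp (- w)" "\<lambda>w. - exp (- w)"])
    show "convex {w. 0 \<le> Re w}" by (simp add: convex_halfspace_Re_ge)
    show "((\<lambda>w. exp (- w)) has_field_derivative - exp (- z)) (at z within {w. 0 \<le> Re w})" for z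
      by (auto intro!: derivative_eq_intros)
  qed (use assms in auto)
  then show ?thesis by (simp add: norm_minus_commute)
qed

text \<open>With \<open>s = exp (- (h / n) * cay z)\<close> and \<open>n > 0\<close> this is
  \<open>s ^ n * binomial_tail n s\<close>: a bounded multiple of \<open>exp (- h * cay z)\<close>,
  close to 1 where \<open>h * cmod (cay z)\<close> is small against \<open>n\<close>.\<close>

definition approx_step :: "nat \<Rightarrow> real \<Rightarrow> complex \<Rightarrow> complex" where
  "approx_step n h z = exp (- (of_real h * cay z)) * binomial_tail n (exp (- (of_real (h / n) * cay z)))"

lemma norm_exp_cay_le:
  assumes "cmod z < 1" "0 \<le> h"
  shows "cmod (exp (- (of_real h * cay z))) \<le> 1"
  using Re_cay_pos[OF assms(1)] assms(2) by simp

lemma norm_approx_step_le: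
  assumes "cmod z < 1" "0 \<le> h"
  shows "cmod (approx_step n h z) \<le> 8 ^ n"
proof -
  have "cmod (approx_step n h z) \<le> 1 * 8 ^ n"
    unfolding approx_step_def norm_mult
    using assms by (intro mult_mono norm_exp_cay_le norm_binomial_tail_le) auto
  then show ?thesis by simp
qed

text \<open>The first bound serves near the circle, where the weight is tiny; the second serves
  elsewhere, where \<open>Re (cay z)\<close> controls \<open>cmod (cay z)\<close>.\<close>

lemma norm_one_minus_approx_step_le:
  assumes z: "cmod z < 1" and h: "0 \<le> h" and n: "0 < n"
  shows "cmod (1 - approx_step n h z) \<le> 16 ^ n"
    and "cmod (1 - approx_step n h z) \<le> (8 * (h * cmod (cay z) / n)) ^ n"
proof -
  define s where "s = exp (- (of_real (h / n) * cay z))"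
  have s: "cmod s \<le> 1" unfolding s_def by (rule norm_exp_cay_le[OF z]) (use h in simp)
  have "s ^ n = exp (- (of_real h * cay z))"
    unfolding s_def using n by (simp flip: exp_of_nat_mult)
  then have *: "cmod (1 - approx_step n h z) \<le> (8 * cmod (1 - s)) ^ n"
    using norm_one_minus_binomial_tail_le[OF s, of n] by (simp add: approx_step_def s_def)
  also have "\<dots> \<le> 16 ^ n"
    using norm_one_minus_le[OF s] by (intro power_mono) auto
  finally show "cmod (1 - approx_step n h z) \<le> 16 ^ n" .
  have "cmod (1 - s) \<le> cmod (of_real (h / n) * cay z)"
    unfolding s_def using Re_cay_pos[OF z] h
    by (intro norm_one_minus_exp_le) (simp only: scaleR_complex.simps flip: scaleR_conv_of_real, simp)
  also have "\<dots> = h * cmod (cay z) / n" using h by (simp add: norm_mult norm_divide)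
  finally have "(8 * cmod (1 - s)) ^ n \<le> (8 * (h * cmod (cay z) / n)) ^ n"
    by (intro power_mono) auto
  with * show "cmod (1 - approx_step n h z) \<le> (8 * (h * cmod (cay z) / n)) ^ n" by linarith
qed

text \<open>Lets a weight of size \<open>exp (- 5 * n)\<close> reduce the bound
  \<open>16 ^ n\<close> to \<open>(1 / 4) ^ n\<close>.\<close>

lemma four_power_three_le_exp_five: "(4::real) ^ 3 \<le> exp 5"
proof -
  have "(2.5::real) \<le> exp 1" using exp_ge_one_plus_x_over_n_power_n[of 2 "1::real"] e_approx_32 by (simp add: abs_if split: if_splits) 
  then have "(2.5::real) ^ 5 \<le> exp 1 ^ 5" by (intro power_mono) auto
  also have "exp (1::real) ^ 5 = exp 5" by (simp flip: exp_of_nat_mult)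
  finally show ?thesis by (simp add: power_divide) 
qed

section \<open>Products of steps and the approximation of 1\<close>

context radial_weight begin

text \<open>For \<open>1 - cmod z < T\<close> the weight alone absorbs \<open>16 ^ n\<close>.
  Otherwise the decay of \<open>exp (- \<delta> * Re (cay z))\<close> absorbs the power of
  \<open>cmod (cay z)\<close>.\<close>

lemma weighted_approx_step_error:
  assumes z: "cmod z < 1" and \<delta>: "0 < \<delta>" and T: "0 \<le> T" and n: "0 < n"
    and low: "\<And>t. t \<in> {0<..1} \<Longrightarrow> t < T \<Longrightarrow> 5 * real n \<le> \<Lambda> t"
  shows "cmod (1 - approx_step n (sqrt (\<delta> * n * T) / 32) z) * exp (- \<delta> * Re (cay z) - \<Lambda> (1 - cmod z)) \<le> (1 / 4) ^ n"
    (is "cmod ?E * ?w \<le> _")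
proof -
  define h where "h = sqrt (\<delta> * n * T) / 32"
  have h: "0 \<le> h" using \<delta> T by (simp add: h_def)
  define t where "t = 1 - cmod z"
  have t: "t \<in> {0<..1}" using z by (simp add: t_def)
  note bounds = norm_one_minus_approx_step_le[OF z h n, unfolded h_def]
  show ?thesis
  proof (cases "t < T")
    case True
    have "?w \<le> exp (- (real n * 5))"
      using low[OF t True] mult_nonneg_nonneg[OF less_imp_le[OF \<delta>] Re_cay_pos[OF z]] by (simp add: t_def)
    also have "\<dots> = (1 / exp 5) ^ n"
      by (simp add: exp_minus power_divide exp_of_nat_mult field_simps)
    also have "\<dots> \<le> (1 / 4 ^ 3) ^ n"
      using four_power_three_le_exp_five by (intro power_mono divide_left_mono) auto
    finally have w: "?w \<le> (1 / 64) ^ n" by simp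
    have "cmod ?E * ?w \<le> 16 ^ n * (1 / 64) ^ n"
      using bounds(1) w by (intro mult_mono) auto
    also have "\<dots> = (1 / 4) ^ n" by (simp flip: power_mult_distrib)
    finally show ?thesis .
  next
    case False
    \<comment> \<open>In this unit the error is at most \<open>(x / 4) ^ n\<close> and the decay at
      least that of \<open>exp (- x\<^sup>2 / 4) ^ n\<close>; the value of \<open>h\<close> is
      chosen for this.\<close>
    define x where "x = cmod (cay z) * sqrt (\<delta> * T / n)"
    have x: "0 \<le> x" using \<delta> T by (simp add: x_def)
    have x2: "real n * (x\<^sup>2 / 4) = \<delta> * ((cmod (cay z))\<^sup>2 * T / 4)"
      using \<delta> T n by (simp add: x_def power_mult_distrib)
    have hx: "h * cmod (cay z) / n = x / 32"
    proof -
      have eq: "sqrt (\<delta> * n * T) / n = sqrt (\<delta> * T / n)"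
        using n by (simp add: real_sqrt_mult real_sqrt_divide) (simp add: field_simps)
      have "h * cmod (cay z) / n = cmod (cay z) * (sqrt (\<delta> * n * T) / n) / 32"
        by (simp add: h_def mult_ac)
      then show ?thesis by (simp only: eq x_def)
    qed
    have "\<delta> * ((cmod (cay z))\<^sup>2 * T / 4) \<le> \<delta> * ((cmod (cay z))\<^sup>2 * t / 4)"
      using False \<delta> by (intro mult_left_mono divide_right_mono) auto
    also have "\<dots> \<le> \<delta> * Re (cay z)"
      using Re_cay_lower[OF z] \<delta> by (intro mult_left_mono) (auto simp: t_def)
    finally have "?w \<le> exp (- (real n * (x\<^sup>2 / 4)))"
      using pos[OF t] x2 by (simp add: t_def)
    also have "\<dots> = exp (- (x\<^sup>2 / 4)) ^ n"
      by (simp flip: exp_of_nat_mult)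
    finally have w: "?w \<le> exp (- (x\<^sup>2 / 4)) ^ n" .
    \<comment> \<open>This is \<open>(x / 2 - 1)\<^sup>2 \<ge> 0\<close>.\<close>
    have "x \<le> 1 + x\<^sup>2 / 4"
      using zero_le_power2[of "x / 2 - 1"] by (simp add: power2_eq_square field_simps)
    also have "\<dots> \<le> exp (x\<^sup>2 / 4)" by (rule exp_ge_add_one_self)
    finally have xe: "x * exp (- (x\<^sup>2 / 4)) \<le> 1"
      by (simp add: exp_minus field_simps)
    have "cmod ?E * ?w \<le> (8 * (x / 32)) ^ n * exp (- (x\<^sup>2 / 4)) ^ n"
      using bounds(2) w x unfolding hx[unfolded h_def] by (intro mult_mono) auto
    also have "\<dots> = (1 / 4 * (x * exp (- (x\<^sup>2 / 4)))) ^ n"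
      by (simp flip: power_mult_distrib)
    also have "\<dots> \<le> (1 / 4 * 1) ^ n"
      using xe x by (intro power_mono mult_left_mono) auto
    finally show ?thesis by simp
  qed
qed

text \<open>The steps for \<open>n = 4 ^ k\<close> with \<open>a \<le> k < K\<close> are multiplied.
  A late start \<open>a\<close> makes the total error small, and divergence provides an end
  \<open>K\<close> at which the shifts \<open>h k\<close> add up to at least 1, enough to split off
  \<open>atomic_inner\<close>.\<close>

lemma approximable_exp_cay:
  assumes T: "\<And>k. 0 \<le> T k" and low: "\<And>k t. t \<in> {0<..1} \<Longrightarrow> t < T k \<Longrightarrow> 5 * 4 ^ k \<le> \<Lambda> t"
    and div: "\<not> summable (\<lambda>k. 2 ^ k * sqrt (T k))" and \<delta>: "0 < \<delta>"
  shows "approximable (\<lambda>z. exp (- (of_real \<delta> * cay z)))"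
proof (rule approximable_limit)
  show "(\<lambda>z. exp (- (of_real \<delta> * cay z))) holomorphic_on ball 0 1"
    by (intro holomorphic_intros cay_holomorphic)
  fix e :: real assume e: "0 < e"
  obtain c where c: "0 < c" "pi * c powr p < e" using exists_small_sup[OF e] .
  define h where "h k = sqrt (\<delta> * 4 ^ k * T k) / 32" for k
  have h_nonneg: "0 \<le> h k" for k using T \<delta> by (simp add: h_def)
  have h_eq: "h k = sqrt \<delta> / 32 * (2 ^ k * sqrt (T k))" for k
  proof -
    have "sqrt (4 ^ k) = (2::real) ^ k" by (simp add: real_sqrt_power)
    then show ?thesis by (simp add: h_def real_sqrt_mult)
  qed
  \<comment> \<open>The errors from step \<open>a\<close> on add up to at most
    \<open>2 * (1 / 2) ^ a\<close>.\<close>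
  obtain a where a: "2 * (1 / 2) ^ a < c"
    using real_arch_pow_inv[of "c / 2" "1 / 2"] c by (auto simp: mult.commute)
  obtain K where K: "a \<le> K" "1 \<le> (\<Sum>k\<in>{a..<K}. h k)"
  proof -
    have "\<not> summable h"
    proof
      assume "summable h"
      then have "summable (\<lambda>k. 32 / sqrt \<delta> * h k)" by (rule summable_mult)
      then show False using div \<delta> by (simp add: h_eq)
    qed
    then have "\<not> (\<forall>N. (\<Sum>k<N. h k) \<le> (\<Sum>k<a. h k) + 1)"
      using summableI_nonneg_bounded[of h] h_nonneg by blast
    then obtain N where N: "(\<Sum>k<a. h k) + 1 < (\<Sum>k<N. h k)" by (auto simp: not_le)
    have "a \<le> N"
    proof (rule ccontr)
      assume "\<not> a \<le> N"
      then have "(\<Sum>k<N. h k) \<le> (\<Sum>k<a. h k)" using h_nonneg by (intro sum_mono2) auto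
      with N show False by simp
    qed
    then have "(\<Sum>k<N. h k) = (\<Sum>k<a. h k) + (\<Sum>k\<in>{a..<N}. h k)"
      by (metis lessThan_atLeast0 sum.atLeastLessThan_concat zero_le)
    then show thesis using that[OF \<open>a \<le> N\<close>] N by simp
  qed
  define Q where "Q m z = (\<Prod>k\<in>{a..<m}. approx_step (4 ^ k) (h k) z)" for m z
  \<comment> \<open>The exponent reproduces itself because \<open>2 * 8 = 2 ^ 4\<close>.\<close>
  have Q_bound: "cmod (Q m z) \<le> 2 ^ (4 ^ m)" if "a \<le> m" "cmod z < 1" for m z
    using that(1)
  proof (induction m rule: dec_induct)
    case base
    then show ?case by (simp add: Q_def)
  next
    case (step m)
    have "Q (Suc m) z = Q m z * approx_step (4 ^ m) (h m) z"
      using step by (simp add: Q_def prod.atLeastLessThan_Suc)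
    then have "cmod (Q (Suc m) z) \<le> 2 ^ (4 ^ m) * 8 ^ (4 ^ m)"
      using step norm_approx_step_le[OF that(2) h_nonneg] by (simp add: norm_mult mult_mono)
    also have "\<dots> = (2 ^ 4) ^ (4 ^ m)" by (simp flip: power_mult_distrib)
    also have "\<dots> = 2 ^ (4 ^ Suc m)" by (simp only: power_mult[symmetric] power_Suc)
    finally show ?case .
  qed
  \<comment> \<open>Step \<open>k\<close> adds at most
    \<open>2 ^ (4 ^ k) * (1 / 4) ^ (4 ^ k) \<le> (1 / 2) ^ k\<close>; the right side is the
    geometric sum of these for \<open>a \<le> k < m\<close>.\<close>
  have error: "cmod (1 - Q m z) * exp (- \<delta> * Re (cay z) - \<Lambda> (1 - cmod z)) \<le> 2 * (1 / 2) ^ a - 2 * (1 / 2) ^ m"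
    if "a \<le> m" "cmod z < 1" for m z
    using that(1)
  proof (induction m rule: dec_induct)
    case base
    then show ?case by (simp add: Q_def)
  next
    case (step m)
    define w where "w = exp (- \<delta> * Re (cay z) - \<Lambda> (1 - cmod z))"
    have "1 - Q (Suc m) z = (1 - Q m z) + Q m z * (1 - approx_step (4 ^ m) (h m) z)"
      using step by (simp add: Q_def prod.atLeastLessThan_Suc algebra_simps)
    then have "cmod (1 - Q (Suc m) z) \<le> cmod (1 - Q m z) + cmod (Q m z) * cmod (1 - approx_step (4 ^ m) (h m) z)"
      using norm_triangle_ineq by (metis norm_mult)
    then have "cmod (1 - Q (Suc m) z) * w \<le> (cmod (1 - Q m z) + cmod (Q m z) * cmod (1 - approx_step (4 ^ m) (h m) z)) * w"
      by (intro mult_right_mono) (auto simp: w_def)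
    also have "\<dots> = cmod (1 - Q m z) * w + cmod (Q m z) * (cmod (1 - approx_step (4 ^ m) (h m) z) * w)"
      by (simp add: algebra_simps)
    also have "\<dots> \<le> (2 * (1 / 2) ^ a - 2 * (1 / 2) ^ m) + 2 ^ (4 ^ m) * (1 / 4) ^ (4 ^ m)"
    proof (intro add_mono mult_mono)
      show "cmod (1 - Q m z) * w \<le> 2 * (1 / 2) ^ a - 2 * (1 / 2) ^ m"
        using step.IH by (simp add: w_def)
      show "cmod (1 - approx_step (4 ^ m) (h m) z) * w \<le> (1 / 4) ^ (4 ^ m)"
        using weighted_approx_step_error[OF that(2) \<delta> T[of m], of "4 ^ m"] low[of _ m] by (simp add: w_def h_def)
    qed (use Q_bound step that(2) in \<open>auto simp: w_def\<close>)
    also have "2 ^ (4 ^ m) * (1 / 4 :: real) ^ (4 ^ m) = (1 / 2) ^ (4 ^ m)"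
      by (simp flip: power_mult_distrib)
    also have "(1 / 2 :: real) ^ (4 ^ m) \<le> (1 / 2) ^ m"
    proof (rule power_decreasing)
      show "m \<le> 4 ^ m" using less_exp[of m] power_mono[of "2::nat" 4 m] by linarith
    qed auto
    finally show ?case by (simp add: w_def)
  qed
  \<comment> \<open>What is left of the total shift after one factor \<open>exp (- cay z)\<close> is
    split off; positivity keeps \<open>g\<close> bounded.\<close>
  define \<sigma> where "\<sigma> = \<delta> + (\<Sum>k\<in>{a..<K}. h k) - 1"
  have \<sigma>: "0 < \<sigma>" using K \<delta> by (simp add: \<sigma>_def)
  define P where "P z = (\<Prod>k\<in>{a..<K}. binomial_tail (4 ^ k) (exp (- (of_real (h k / real (4 ^ k)) * cay z))))" for z
  define g where "g z = exp (- (of_real \<sigma> * cay z)) * P z" for z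
  have eq: "exp (- (of_real \<delta> * cay z)) * Q K z = g z * atomic_inner z" for z
  proof -
    have "Q K z = exp (\<Sum>k\<in>{a..<K}. - (of_real (h k) * cay z)) * P z"
      by (simp add: Q_def approx_step_def prod.distrib P_def exp_sum)
    moreover have "exp (- (of_real \<delta> * cay z)) * exp (\<Sum>k\<in>{a..<K}. - (of_real (h k) * cay z)) =
        exp (- (of_real \<sigma> * cay z)) * exp (- cay z)"
      by (simp add: \<sigma>_def sum_negf algebra_simps sum_distrib_left flip: exp_add)
    ultimately show ?thesis by (simp add: g_def atomic_inner_cay mult_ac)
  qed
  have g_hol: "g holomorphic_on ball 0 1"
    unfolding g_def P_def binomial_tail_def by (intro holomorphic_intros cay_holomorphic)
  have "approximable (\<lambda>z. g z * atomic_inner z)"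
  proof (rule approximable_bounded_mult[OF g_hol])
    fix z :: complex assume z: "cmod z < 1"
    have "cmod (P z) \<le> (\<Prod>k\<in>{a..<K}. 8 ^ (4 ^ k))"
      unfolding P_def
    proof (rule order_trans[OF norm_prod_le prod_mono], intro conjI norm_ge_zero norm_binomial_tail_le)
      show "cmod (exp (- (of_real (h k / real (4 ^ k)) * cay z))) \<le> 1" for k
        by (rule norm_exp_cay_le[OF z]) (use h_nonneg in simp)
    qed
    then have "cmod (g z) \<le> 1 * (\<Prod>k\<in>{a..<K}. 8 ^ (4 ^ k))"
      unfolding g_def norm_mult using norm_exp_cay_le[OF z, of \<sigma>] \<sigma> by (intro mult_mono) auto
    then show "cmod (g z) \<le> (\<Prod>k\<in>{a..<K}. 8 ^ (4 ^ k))" by simp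
  qed
  moreover have "(\<lambda>z. g z * atomic_inner z) holomorphic_on ball 0 1"
    by (intro holomorphic_intros g_hol atomic_inner_holomorphic)
  moreover have "wi (\<lambda>z. g z * atomic_inner z - exp (- (of_real \<delta> * cay z))) < ennreal e"
  proof -
    have "wi (\<lambda>z. g z * atomic_inner z - exp (- (of_real \<delta> * cay z))) \<le> ennreal (pi * c powr p)"
    proof (rule wi_le_sup)
      fix z :: complex assume z: "cmod z < 1"
      have "g z * atomic_inner z - exp (- (of_real \<delta> * cay z)) = - (exp (- (of_real \<delta> * cay z)) * (1 - Q K z))"
        unfolding eq[symmetric] by (simp add: algebra_simps)
      then have "cmod (g z * atomic_inner z - exp (- (of_real \<delta> * cay z))) * exp (- \<Lambda> (1 - cmod z)) =
          cmod (1 - Q K z) * exp (- \<delta> * Re (cay z) - \<Lambda> (1 - cmod z))"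
        by (simp add: norm_mult mult_ac flip: exp_add)
      also have "\<dots> \<le> 2 * (1 / 2) ^ a - 2 * (1 / 2) ^ K"
        by (rule error[OF K(1) z])
      also have "\<dots> \<le> c" using a by (smt (verit) zero_le_power half_gt_zero)
      finally show "cmod (g z * atomic_inner z - exp (- (of_real \<delta> * cay z))) * exp (- \<Lambda> (1 - cmod z)) \<le> c" .
    qed
    also have "\<dots> < ennreal e" using c e by (intro ennreal_lessI) auto
    finally show ?thesis .
  qed
  ultimately show "\<exists>g. g holomorphic_on ball 0 1 \<and> approximable g \<and> wi (\<lambda>z. g z - exp (- (of_real \<delta> * cay z))) < ennreal e"
    by blast
qed

text \<open>The functions \<open>exp (- cay z / (n + 1))\<close> are approximable, bounded by 1 and
  tend to 1 pointwise. The levels \<open>5 * 4 ^ k\<close> are those required by a step with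
  \<open>n = 4 ^ k\<close>.\<close>

lemma approximable_one_of_divergence:
  assumes inf: "(\<integral>\<^sup>+ t \<in> {0<..1}. ennreal (sqrt (\<Lambda> t / t)) \<partial>lborel) = \<infinity>"
  shows "approximable (\<lambda>z. 1)"
proof (rule approximable_limit)
  have "\<exists>T. 0 \<le> T \<and> T \<le> 1 \<and> (\<forall>t\<in>{0<..1}. (t < T \<longrightarrow> 5 * 4 ^ k \<le> \<Lambda> t) \<and> (5 * 4 ^ k \<le> \<Lambda> t \<longrightarrow> t \<le> T))" for k :: nat
    by (rule antimono_threshold[OF anti, of "5 * 4 ^ k"]) blast
  then obtain T where T: "\<And>k::nat. 0 \<le> T k \<and> T k \<le> 1 \<and>
      (\<forall>t\<in>{0<..1}. (t < T k \<longrightarrow> 5 * 4 ^ k \<le> \<Lambda> t) \<and> (5 * 4 ^ k \<le> \<Lambda> t \<longrightarrow> t \<le> T k))"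
    by metis
  interpret threshold \<Lambda> 5 T
    by unfold_locales (use pos T in auto)
  have div: "\<not> summable (\<lambda>k. 2 ^ k * sqrt (T k))"
    using summable_imp_finite_integral inf by auto
  fix e :: real assume e: "0 < e"
  define d where "d n z = exp (- (of_real (1 / (real n + 1)) * cay z))" for n z
  have d_hol: "d n holomorphic_on ball 0 1" for n
    unfolding d_def by (intro holomorphic_intros cay_holomorphic)
  have "(\<lambda>n. wi (\<lambda>z. d n z - 1)) \<longlonglongrightarrow> 0"
  proof (rule wi_tendsto_zero[of "\<lambda>n z. d n z - 1" 2])
    show "(\<lambda>z. d n z - 1) holomorphic_on ball 0 1" for n
      by (intro holomorphic_intros d_hol)
    show "cmod (d n z - 1) \<le> 2" if "cmod z < 1" for n z
      using norm_one_minus_le[OF norm_exp_cay_le[OF that, of "1 / (real n + 1)"]]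
      by (simp add: d_def norm_minus_commute)
    fix z :: complex
    have "(\<lambda>n. 1 / (real n + 1)) \<longlonglongrightarrow> 0" by real_asymp
    then have "(\<lambda>n. d n z) \<longlonglongrightarrow> exp (- (of_real 0 * cay z))"
      unfolding d_def by (intro tendsto_intros)
    then show "(\<lambda>n. d n z - 1) \<longlonglongrightarrow> 0" by (simp add: LIM_zero)
  qed
  then have "eventually (\<lambda>n. wi (\<lambda>z. d n z - 1) < ennreal e) sequentially"
    using e by (intro order_tendstoD(2)) auto
  then obtain n where "wi (\<lambda>z. d n z - 1) < ennreal e"
    using eventually_happens sequentially_bot by blast
  moreover have "approximable (d n)"
    unfolding d_def by (rule approximable_exp_cay[OF _ _ div]) (use T in auto)
  ultimately show "\<exists>g. g holomorphic_on ball 0 1 \<and> approximable g \<and> wi (\<lambda>z. g z - 1) < ennreal e"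
    using d_hol by blast
qed simp

end

subsection \<open>Convergence excludes cyclicity\<close>

text \<open>A substitute for Hoelder's inequality when the mean of \<open>cmod f\<close> is bounded
  through its p-th power.\<close>

lemma le_one_plus_powr:
  fixes x p :: real
  assumes "0 \<le> x" "1 \<le> p"
  shows "x \<le> 1 + x powr p"
proof (cases "x \<le> 1")
  case False
  then have "x powr 1 \<le> x powr p" using assms by (intro powr_mono) auto
  then show ?thesis using False by simp
qed (use powr_ge_zero[of x p] in linarith)

text \<open>The integrand is \<open>sqrt (1 / sqrt t / t)\<close>: what a term of order
  \<open>1 / sqrt t\<close> in the growth bound contributes to the integral.\<close>

lemma nn_integral_powr_three_quarters:
  "(\<integral>\<^sup>+t\<in>{0<..1}. ennreal (t powr (- 3 / 4)) \<partial>lborel) = ennreal 4"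
proof -
  have "((\<lambda>t::real. t powr (- 3 / 4)) has_integral 4) {0..1}"
    using has_integral_powr_from_0[of "- 3 / 4" 1] by simp
  moreover have "((\<lambda>t::real. t powr (- 3 / 4)) has_integral y) {0<..1} \<longleftrightarrow> ((\<lambda>t. t powr (- 3 / 4)) has_integral y) {0..1}" for y
    by (rule has_integral_spike_set_eq) (auto intro: negligible_subset[of "{0}"])
  ultimately have "((\<lambda>t::real. t powr (- 3 / 4)) has_integral 4) {0<..1}" by simp
  then show ?thesis
    by (intro nn_integral_has_integral_lebesgue') auto
qed

section \<open>The harmonic barrier\<close>

text \<open>The real part of \<open>barrier\<close> is at least a quarter of \<open>4 ^ Suc k\<close> as soon as
  \<open>2 / \<bar>1 - z\<bar> \<ge> r k\<close>, but grows only like \<open>(\<Sum>k. 4 ^ Suc k / r k) * 2 / (1 - x)\<close> along the radius.\<close>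

definition barrier :: "(nat \<Rightarrow> real) \<Rightarrow> nat set \<Rightarrow> complex \<Rightarrow> complex" where
  "barrier r K z = (\<Sum>k\<in>K. of_real (4 ^ Suc k) * (2 / (2 + of_real (r k) * (1 - z))))"

lemma barrier_denominator:
  assumes z: "cmod z \<le> 1" and r: "0 \<le> (r::real)"
  shows "2 \<le> Re (2 + of_real r * (1 - z))"
  using complex_Re_le_cmod[of z] z r by simp

lemma barrier_denominator_nonzero:
  assumes "cmod z \<le> 1" "0 \<le> (r::real)"
  shows "2 + of_real r * (1 - z) \<noteq> 0"
  using barrier_denominator[OF assms] by (metis zero_complex.sel(1) not_numeral_le_zero)

text \<open>With \<open>W = 2 / (1 - z) = 1 + cay z\<close> the quotient is
  \<open>W / (W + r)\<close>; in the present form it has no singularity at \<open>z = 1\<close>. The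
  second bound holds because the denominator then has modulus at most 4.\<close>

lemma Re_barrier_term:
  assumes z: "cmod z \<le> 1" and r: "0 \<le> (r::real)"
  shows "0 \<le> Re (2 / (2 + of_real r * (1 - z)))"
    and "r * cmod (1 - z) \<le> 2 \<Longrightarrow> 1 / 4 \<le> Re (2 / (2 + of_real r * (1 - z)))"
proof -
  define d where "d = 2 + of_real r * (1 - z)"
  have d: "2 \<le> Re d" unfolding d_def by (rule barrier_denominator[OF z r])
  have Re: "Re (2 / d) = 2 * Re d / (cmod d)\<^sup>2"
    by (simp add: Re_divide cmod_power2)
  show "0 \<le> Re (2 / d)" unfolding Re using d by simp
  show "1 / 4 \<le> Re (2 / d)" if "r * cmod (1 - z) \<le> 2"
  proof -
    have "cmod d \<le> 2 + r * cmod (1 - z)"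
      unfolding d_def using norm_triangle_ineq[of 2 "of_real r * (1 - z)"] r by (simp add: norm_mult)
    then have "cmod d \<le> 4" using that by simp
    then have "(cmod d)\<^sup>2 \<le> 4\<^sup>2" by (intro power_mono) auto
    moreover have "0 < cmod d" using d complex_Re_le_cmod[of d] by linarith
    ultimately show ?thesis unfolding Re using d by (simp add: field_simps)
  qed
qed

lemma Re_barrier_ge:
  assumes z: "cmod z \<le> 1" and r: "\<And>k. 0 \<le> r k" and K: "finite K"
  shows "0 \<le> Re (barrier r K z)"
    and "k \<in> K \<Longrightarrow> r k * cmod (1 - z) \<le> 2 \<Longrightarrow> 4 ^ k \<le> Re (barrier r K z)"
proof -
  define b where "b k = 4 ^ Suc k * Re (2 / (2 + of_real (r k) * (1 - z)))" for k
  have b: "0 \<le> b k" for k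
    unfolding b_def using Re_barrier_term(1)[OF z r[of k]] by (intro mult_nonneg_nonneg) auto
  have eq: "Re (barrier r K z) = sum b K"
  proof -
    have "Re (of_real c * w) = c * Re w" for c w by simp
    then show ?thesis unfolding barrier_def b_def Re_sum by (simp only:)
  qed
  show "0 \<le> Re (barrier r K z)" unfolding eq using b by (intro sum_nonneg)
  show "4 ^ k \<le> Re (barrier r K z)" if k: "k \<in> K" "r k * cmod (1 - z) \<le> 2"
  proof -
    have "4 ^ k = 4 ^ Suc k * (1 / 4 :: real)" by simp
    also have "\<dots> \<le> b k"
      unfolding b_def using Re_barrier_term(2)[OF z r k(2)] by (intro mult_left_mono) auto
    also have "\<dots> \<le> sum b K" using k K b by (intro member_le_sum) auto
    finally show ?thesis unfolding eq .
  qed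
qed

lemma barrier_continuous:
  assumes "\<And>k. 0 \<le> r k"
  shows "continuous_on (cball 0 1) (barrier r K)"
proof -
  have "2 + of_real (r k) * (1 - z) \<noteq> 0" if "z \<in> cball 0 1" for k and z :: complex
    by (rule barrier_denominator_nonzero) (use assms that in auto)
  then show ?thesis unfolding barrier_def[abs_def] by (intro continuous_intros) auto
qed

lemma barrier_holomorphic:
  assumes "\<And>k. 0 \<le> r k"
  shows "barrier r K holomorphic_on ball 0 1"
proof -
  have "2 + of_real (r k) * (1 - z) \<noteq> 0" if "z \<in> ball 0 1" for k and z :: complex
    by (rule barrier_denominator_nonzero) (use assms that in auto)
  then show ?thesis unfolding barrier_def[abs_def] by (intro holomorphic_intros) auto
qed

text \<open>On the radius \<open>W = 2 / (1 - x)\<close> is real and positive, so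
  \<open>W / (W + r) \<le> W / r\<close>.\<close>

lemma barrier_real_le:
  assumes x: "0 \<le> x" "x < 1" and r: "\<And>k. 0 < r k"
  shows "Re (barrier r K (of_real x)) \<le> (\<Sum>k\<in>K. 4 ^ Suc k / r k) * (2 / (1 - x))"
proof -
  have "Re (barrier r K (of_real x)) = (\<Sum>k\<in>K. 4 ^ Suc k * (2 / (2 + r k * (1 - x))))"
  proof -
    have "of_real (4 ^ Suc k) * (2 / (2 + of_real (r k) * (1 - of_real x))) =
        (of_real (4 ^ Suc k * (2 / (2 + r k * (1 - x)))) :: complex)" for k
      by simp
    then show ?thesis unfolding barrier_def Re_sum by (simp only: Re_complex_of_real)
  qed
  also have "\<dots> \<le> (\<Sum>k\<in>K. 4 ^ Suc k / r k * (2 / (1 - x)))"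
  proof (rule sum_mono)
    fix k
    have "2 / (2 + r k * (1 - x)) \<le> 2 / (r k * (1 - x))"
      using x r[of k] by (intro divide_left_mono mult_pos_pos add_pos_pos) auto
    then have "4 ^ Suc k * (2 / (2 + r k * (1 - x))) \<le> 4 ^ Suc k * (2 / (r k * (1 - x)))"
      by (intro mult_left_mono) auto
    then show "4 ^ Suc k * (2 / (2 + r k * (1 - x))) \<le> 4 ^ Suc k / r k * (2 / (1 - x))"
      by simp
  qed
  finally show ?thesis by (simp only: sum_distrib_right)
qed

section \<open>Growth of functions in the space\<close>

context radial_weight begin

text \<open>Mean value over the disc of radius \<open>(1 - cmod z) / 2\<close>, on which the weight
  is bounded below. The scale \<open>\<eta>\<close> is free: \<open>\<eta> = 1\<close> gives a
  growth bound, and a small \<open>\<eta>\<close> gives smallness at a fixed point once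
  \<open>I\<close> is small.\<close>

lemma pointwise_bound:
  assumes f: "f holomorphic_on ball 0 1" and I: "wi f \<le> ennreal I" "0 \<le> I"
    and z: "cmod z < 1" and \<eta>: "0 < \<eta>"
  shows "cmod (f z) \<le> \<eta> * (1 + 4 * exp (p * \<Lambda> ((1 - cmod z) / 2)) / (pi * (1 - cmod z)\<^sup>2) * (I / \<eta> powr p))"
proof -
  define t where "t = 1 - cmod z"
  have t: "0 < t" "t \<le> 1" using z by (auto simp: t_def)
  define C where "C = exp (p * \<Lambda> (t / 2)) / \<eta> powr p"
  have C: "0 \<le> C" by (simp add: C_def)
  define D where "D = ball z (t / 2)"
  have norm_less: "cmod w < 1 - t / 2" if "w \<in> D" for w
  proof -
    have "cmod (w - z) < (1 - cmod z) / 2" using that by (simp add: D_def t_def dist_norm norm_minus_commute)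
    moreover have "cmod w \<le> cmod z + cmod (w - z)" by (rule norm_triangle_sub)
    ultimately show ?thesis unfolding t_def by argo
  qed
  have D_sub: "D \<subseteq> ball 0 1" using norm_less t by fastforce
  have area: "emeasure lborel D = ennreal (pi * t\<^sup>2 / 4)"
    using t by (simp add: D_def emeasure_ball unit_ball_vol_2 power_divide)
  have g: "(\<lambda>w. f w / of_real \<eta>) holomorphic_on ball z (t / 2)"
    using holomorphic_on_subset[OF f D_sub] \<eta> unfolding D_def by (intro holomorphic_intros) auto
  have "ennreal (cmod (f z) / \<eta>) * ennreal (pi * t\<^sup>2 / 4) \<le> (\<integral>\<^sup>+w\<in>D. ennreal (cmod (f w) / \<eta>) \<partial>lborel)"
    using submean_value_ball[OF g] \<eta> unfolding area[symmetric] D_def[symmetric] by (simp add: norm_divide)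
  also have "\<dots> \<le> (\<integral>\<^sup>+w. indicator D w + ennreal C * (ennreal (dens f w) * indicator (ball 0 1) w) \<partial>lborel)"
  proof (intro nn_integral_mono)
    fix w :: complex
    show "ennreal (cmod (f w) / \<eta>) * indicator D w \<le> indicator D w + ennreal C * (ennreal (dens f w) * indicator (ball 0 1) w)"
    proof (cases "w \<in> D")
      case True
      have "\<Lambda> (1 - cmod w) \<le> \<Lambda> (t / 2)"
        using norm_less[OF True] t by (intro monotone_onD[OF anti]) auto
      then have "1 \<le> exp (p * \<Lambda> (t / 2)) * exp (- p * \<Lambda> (1 - cmod w))"
        using p by (simp flip: exp_add)
      then have "cmod (f w) powr p * 1 \<le> cmod (f w) powr p * (exp (p * \<Lambda> (t / 2)) * exp (- p * \<Lambda> (1 - cmod w)))"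
        by (intro mult_left_mono) auto
      then have "cmod (f w) powr p / \<eta> powr p \<le> C * dens f w"
        using divide_right_mono[of _ _ "\<eta> powr p"] by (fastforce simp: C_def dens_def mult_ac)
      moreover have "cmod (f w) / \<eta> \<le> 1 + (cmod (f w) / \<eta>) powr p"
        using \<eta> p by (intro le_one_plus_powr) auto
      ultimately have "cmod (f w) / \<eta> \<le> 1 + C * dens f w"
        using \<eta> by (simp add: powr_divide)
      then have "ennreal (cmod (f w) / \<eta>) \<le> ennreal (1 + C * dens f w)" by (rule ennreal_leI)
      also have "\<dots> = 1 + ennreal C * ennreal (dens f w)"
        using C by (simp add: ennreal_plus ennreal_mult)
      finally show ?thesis using True D_sub by auto
    qed simp
  qed
  also have "\<dots> = emeasure lborel D + ennreal C * wi f"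
    using dens_measurable[OF f]
    by (subst nn_integral_add) (auto simp: D_def wi_dens nn_integral_cmult intro!: borel_measurable_indicator)
  also have "\<dots> \<le> ennreal (pi * t\<^sup>2 / 4) + ennreal C * ennreal I"
    unfolding area using I by (intro add_left_mono mult_left_mono) auto
  also have "\<dots> = ennreal (pi * t\<^sup>2 / 4 + C * I)"
    using C I by (simp add: ennreal_plus ennreal_mult)
  finally have "ennreal (cmod (f z) / \<eta> * (pi * t\<^sup>2 / 4)) \<le> ennreal (pi * t\<^sup>2 / 4 + C * I)"
    using \<eta> by (subst ennreal_mult) auto
  then have "cmod (f z) / \<eta> * (pi * t\<^sup>2 / 4) \<le> pi * t\<^sup>2 / 4 + C * I"
    using C I by (subst (asm) ennreal_le_iff) auto
  then have "cmod (f z) / \<eta> \<le> (pi * t\<^sup>2 / 4 + C * I) / (pi * t\<^sup>2 / 4)"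
    using t by (subst pos_le_divide_eq) auto
  also have "\<dots> = 1 + 4 * exp (p * \<Lambda> (t / 2)) / (pi * t\<^sup>2) * (I / \<eta> powr p)"
    using t by (simp add: C_def field_simps)
  finally show ?thesis using \<eta> by (simp add: t_def pos_divide_le_eq mult.commute)
qed

text \<open>The logarithm of the bound of \<open>pointwise_bound\<close>, made generous:
  \<open>4 / sqrt t\<close> absorbs the factor \<open>1 / t\<^sup>2\<close> without spoiling the
  integral and also forces the growth to be unbounded; 2 absorbs the constants.\<close>

definition growth :: "real \<Rightarrow> real" where
  "growth t = p * \<Lambda> (t / 2) + 4 / sqrt t + 2"

lemma growth_pos: "t \<in> {0<..1} \<Longrightarrow> 0 < growth t"
  using p pos[of "t / 2"] by (auto simp: growth_def intro!: add_nonneg_pos add_nonneg_nonneg)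

lemma growth_antimono: "antimono_on {0<..1} growth"
proof (rule monotone_onI)
  fix s t :: real assume st: "s \<in> {0<..1}" "t \<in> {0<..1}" "s \<le> t"
  have "\<Lambda> (t / 2) \<le> \<Lambda> (s / 2)" using st by (intro monotone_onD[OF anti]) auto
  moreover have "4 / sqrt t \<le> 4 / sqrt s" using st by (intro divide_left_mono) auto
  ultimately show "growth t \<le> growth s"
    unfolding growth_def using p by (intro add_mono mult_left_mono) auto
qed

text \<open>The fourth power of \<open>1 / sqrt t \<le> exp (1 / sqrt t)\<close> handles
  \<open>1 / t\<^sup>2\<close>, and \<open>4 \<le> exp 2\<close> the numerical factor.\<close>

lemma bound_le_exp_growth:
  assumes t: "t \<in> {0<..1}"
  shows "2 + 4 * exp (p * \<Lambda> (t / 2)) / (pi * t\<^sup>2) \<le> exp (growth t)"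
proof -
  have "1 / sqrt t \<le> exp (1 / sqrt t)"
    using exp_ge_add_one_self[of "1 / sqrt t"] by linarith
  then have "(1 / sqrt t) ^ 4 \<le> exp (1 / sqrt t) ^ 4"
    using t by (intro power_mono) auto
  moreover have "(sqrt t) ^ 4 = t\<^sup>2"
    using t by (simp add: power4_eq_xxxx power2_eq_square)
  ultimately have inv: "1 / t\<^sup>2 \<le> exp (4 / sqrt t)"
    by (simp add: power_divide flip: exp_of_nat_mult)
  have four: "(4::real) \<le> exp 2"
  proof -
    have "(2::real) ^ 2 \<le> exp 1 ^ 2" using exp_ge_add_one_self[of "1::real"] by (intro power_mono) auto
    then show ?thesis by (simp flip: exp_of_nat_mult)
  qed
  define X where "X = exp (p * \<Lambda> (t / 2))"
  have X: "1 \<le> X" using p pos[of "t / 2"] t by (simp add: X_def)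
  have "1 \<le> 1 / t\<^sup>2" using t by (simp add: power_le_one)
  then have "1 * 1 \<le> X * (1 / t\<^sup>2)" using X by (intro mult_mono) auto
  then have "2 \<le> 2 * (X * (1 / t\<^sup>2))" by simp
  moreover have "4 * X / (pi * t\<^sup>2) \<le> 2 * (X * (1 / t\<^sup>2))"
  proof -
    have "4 * X / (pi * t\<^sup>2) = (4 / pi) * (X * (1 / t\<^sup>2))" by simp
    also have "\<dots> \<le> 2 * (X * (1 / t\<^sup>2))"
      using X pi_gt3 by (intro mult_right_mono) (auto simp: field_simps)
    finally show ?thesis .
  qed
  ultimately have "2 + 4 * X / (pi * t\<^sup>2) \<le> 2 * (X * (1 / t\<^sup>2)) + 2 * (X * (1 / t\<^sup>2))"
    by (rule add_mono)
  also have "\<dots> = X * (1 / t\<^sup>2) * 4" by simp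
  also have "\<dots> \<le> X * exp (4 / sqrt t) * exp 2"
    using X inv four by (intro mult_mono) auto
  also have "\<dots> = exp (growth t)" by (simp add: X_def growth_def exp_add)
  finally show ?thesis by (simp add: X_def)
qed

text \<open>The square root is subadditive. The argument \<open>t / 2\<close> is removed by a change
  of variables, and the other terms are dominated by the integrable
  \<open>t powr (- 3 / 4)\<close>.\<close>

lemma growth_integral_finite:
  assumes fin: "(\<integral>\<^sup>+ t \<in> {0<..1}. ennreal (sqrt (\<Lambda> t / t)) \<partial>lborel) < \<infinity>"
  shows "(\<integral>\<^sup>+ t \<in> {0<..1}. ennreal (sqrt (growth t / t)) \<partial>lborel) < \<infinity>"
proof -
  define F where "F t = ennreal (sqrt (\<Lambda> t / t)) * indicator {0<..1} t" for t
  define G where "G t = ennreal (t powr (- 3 / 4)) * indicator {0<..1} t" for t :: real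
  have F_meas: "F \<in> borel_measurable borel"
  proof -
    have "continuous_on {0<..1} (\<lambda>t. sqrt (\<Lambda> t / t))"
      using cont by (intro continuous_intros) auto
    then have "(\<lambda>t. ennreal (indicator {0<..1} t *\<^sub>R sqrt (\<Lambda> t / t))) \<in> borel_measurable borel"
      by (intro measurable_compose[OF _ measurable_ennreal] borel_measurable_continuous_on_indicator) auto
    also have "(\<lambda>t. ennreal (indicator {0<..1} t *\<^sub>R sqrt (\<Lambda> t / t))) = F"
      by (auto simp: F_def fun_eq_iff indicator_def)
    finally show ?thesis .
  qed
  have G_meas: "G \<in> borel_measurable borel"
    unfolding G_def by measurable
  have half: "(\<integral>\<^sup>+t. F t \<partial>lborel) = ennreal (1 / 2) * (\<integral>\<^sup>+t. F (t / 2) \<partial>lborel)"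
    using nn_integral_real_affine[OF F_meas, of "1 / 2" 0] by simp
  have halfF: "(\<integral>\<^sup>+t. F (t / 2) \<partial>lborel) < \<infinity>"
  proof (rule ccontr)
    assume "\<not> (\<integral>\<^sup>+t. F (t / 2) \<partial>lborel) < \<infinity>"
    then have "(\<integral>\<^sup>+t. F (t / 2) \<partial>lborel) = \<infinity>" by (metis less_top infinity_ennreal_def)
    then show False using half fin by (simp add: F_def ennreal_mult_top)
  qed
  have "(\<integral>\<^sup>+ t \<in> {0<..1}. ennreal (sqrt (growth t / t)) \<partial>lborel) \<le>
    (\<integral>\<^sup>+ t. ennreal (sqrt p) * F (t / 2) + ennreal 3 * G t \<partial>lborel)"
  proof (intro nn_integral_mono)
    fix t :: real
    show "ennreal (sqrt (growth t / t)) * indicator {0<..1} t \<le> ennreal (sqrt p) * F (t / 2) + ennreal 3 * G t"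
    proof (cases "t \<in> {0<..1}")
      case t: True
      have \<Lambda>: "0 < \<Lambda> (t / 2)" using pos[of "t / 2"] t by simp
      \<comment> \<open>The terms besides \<Lambda> are collected with the constant 9, a square that
        also covers \<open>4 / sqrt t + 2\<close>.\<close>
      have "growth t / t \<le> p * (\<Lambda> (t / 2) / (t / 2)) + 9 * (1 / t * (1 / sqrt t))"
      proof -
        have "1 \<le> 1 / sqrt t" using t by simp
        moreover have "4 / sqrt t = 4 * (1 / sqrt t)" by simp
        moreover have "0 \<le> p * \<Lambda> (t / 2)" using p \<Lambda> by simp
        ultimately have "growth t \<le> p * (2 * \<Lambda> (t / 2)) + 9 * (1 / sqrt t)"
          unfolding growth_def by linarith
        then have "growth t / t \<le> (p * (2 * \<Lambda> (t / 2)) + 9 * (1 / sqrt t)) / t"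
          using t by (intro divide_right_mono) auto
        then show ?thesis by (simp add: add_divide_distrib mult_ac)
      qed
      then have "sqrt (growth t / t) \<le> sqrt (p * (\<Lambda> (t / 2) / (t / 2)) + 9 * (1 / t * (1 / sqrt t)))"
        by (rule real_sqrt_le_mono)
      also have "\<dots> \<le> sqrt (p * (\<Lambda> (t / 2) / (t / 2))) + sqrt (9 * (1 / t * (1 / sqrt t)))"
        using p \<Lambda> t by (intro sqrt_add_le_add_sqrt) auto
      also have "sqrt (9 * (1 / t * (1 / sqrt t))) = 3 * t powr (- 3 / 4)"
      proof (rule real_sqrt_unique)
        have "(t powr (- 3 / 4))\<^sup>2 = t powr (- 1 + - 1 / 2)"
          by (simp only: power2_eq_square powr_add[symmetric]) simp
        also have "\<dots> = t powr (- 1) * t powr (- 1 / 2)" by (rule powr_add)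
        also have "\<dots> = 1 / t * (1 / sqrt t)"
          using t by (simp add: powr_minus powr_half_sqrt[symmetric] field_simps)
        finally show "(3 * t powr (- 3 / 4))\<^sup>2 = 9 * (1 / t * (1 / sqrt t))"
          by (simp add: power_mult_distrib)
      qed auto
      also have "sqrt (p * (\<Lambda> (t / 2) / (t / 2))) = sqrt p * sqrt (\<Lambda> (t / 2) / (t / 2))"
        by (rule real_sqrt_mult)
      finally have "ennreal (sqrt (growth t / t)) \<le> ennreal (sqrt p * sqrt (\<Lambda> (t / 2) / (t / 2)) + 3 * t powr (- 3 / 4))"
        by (rule ennreal_leI)
      also have "\<dots> = ennreal (sqrt p) * ennreal (sqrt (\<Lambda> (t / 2) / (t / 2))) + ennreal 3 * ennreal (t powr (- 3 / 4))"
        using p \<Lambda> t by (subst ennreal_plus, simp, simp) (subst ennreal_mult, simp, simp, subst ennreal_mult, auto)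
      finally show ?thesis using t by (simp add: F_def G_def)
    qed simp
  qed
  also have "\<dots> = ennreal (sqrt p) * (\<integral>\<^sup>+t. F (t / 2) \<partial>lborel) + ennreal 3 * (\<integral>\<^sup>+t. G t \<partial>lborel)"
    using measurable_compose[OF _ F_meas, of "\<lambda>t. t / 2"] G_meas
    by (simp add: nn_integral_add nn_integral_cmult)
  also have "\<dots> < \<infinity>"
    using halfF nn_integral_powr_three_quarters by (simp add: G_def ennreal_mult_less_top)
  finally show ?thesis .
qed

section \<open>The maximum principle and the contradiction\<close>

text \<open>The maximum principle is applied where \<open>Re (cay z)\<close> exceeds the barrier by more than 1; on the
  frontier of that region the two are tied, so the barrier bounds the distance to the circle below.\<close>

lemma poly_le_exp_barrier:
  assumes r: "\<And>k. 0 < r k"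
    and gap: "\<And>k t. t \<in> {0<..1} \<Longrightarrow> 2 * 4 ^ k / (r (Suc k))\<^sup>2 \<le> t \<Longrightarrow> growth t \<le> 4 ^ Suc k"
    and C0: "0 \<le> C0" "\<And>t. t \<in> {0<..1} \<Longrightarrow> 2 / (r a)\<^sup>2 \<le> t \<Longrightarrow> growth t \<le> C0"
    and q: "\<And>z. cmod z < 1 \<Longrightarrow> cmod (poly q z) \<le> exp (Re (cay z) + growth (1 - cmod z))"
    and B: "\<And>z. cmod z \<le> 1 \<Longrightarrow> cmod (poly q z) \<le> exp (4 ^ m)" and am: "a \<le> m"
    and \<xi>: "cmod \<xi> < 1" "1 + Re (barrier r {a..m} \<xi>) < Re (cay \<xi>)"
  shows "cmod (poly q \<xi>) \<le> exp (C0 + 5 * (1 + Re (barrier r {a..m} \<xi>)))"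
proof -
  define E where "E = barrier r {a..m}"
  define H where "H z = Re (E z)" for z
  define \<phi> where "\<phi> z = Re (cay z) - (1 + H z)" for z
  define S where "S = {z \<in> ball 0 1. 0 < \<phi> z}"
  \<comment> \<open>The polynomial divided by a function whose modulus is the claimed majorant; the
    claim becomes \<open>cmod (F \<xi>) \<le> 1\<close>.\<close>
  define F where "F z = poly q z * exp (- (of_real C0 + 5 * (1 + E z)))" for z
  have r0: "0 \<le> r k" for k using r[of k] by simp
  have H0: "0 \<le> H z" if "cmod z \<le> 1" for z
    unfolding H_def E_def by (rule Re_barrier_ge(1)[OF that r0]) simp
  have H_ge: "4 ^ k \<le> H z" if "cmod z \<le> 1" "a \<le> k" "k \<le> m" "r k * cmod (1 - z) \<le> 2" for z k
    unfolding H_def E_def using that by (intro Re_barrier_ge(2)[OF that(1) r0]) auto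
  have E_cont: "continuous_on (cball 0 1) E"
    unfolding E_def by (rule barrier_continuous[OF r0])
  have F_cont: "continuous_on (cball 0 1) F"
    unfolding F_def by (intro continuous_intros E_cont)
  have F_hol: "F holomorphic_on ball 0 1"
    unfolding F_def E_def by (intro holomorphic_intros barrier_holomorphic r0)
  have norm_F: "cmod (F z) = cmod (poly q z) * exp (- (C0 + 5 * (1 + H z)))" for z
    by (simp add: F_def H_def norm_mult)
  have \<phi>_cont: "continuous_on (cball 0 1 - {1}) \<phi>"
    unfolding \<phi>_def H_def cay_def
    by (intro continuous_intros continuous_on_subset[OF E_cont]) auto
  have S_open: "open S"
  proof -
    have "continuous_on (ball 0 1) \<phi>" by (rule continuous_on_subset[OF \<phi>_cont]) auto
    then have "open (ball 0 1 \<inter> \<phi> -` {0<..})"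
      by (intro continuous_open_preimage) auto
    moreover have "ball 0 1 \<inter> \<phi> -` {0<..} = S" by (auto simp: S_def)
    ultimately show ?thesis by simp
  qed
  have S_sub: "S \<subseteq> ball 0 1" by (auto simp: S_def)
  then have S_cl: "closure S \<subseteq> cball 0 1"
    by (metis closure_mono closure_ball zero_less_one)
  have small: "cmod (F z) \<le> 1" if "cmod (poly q z) \<le> exp (C0 + 5 * (1 + H z))" for z
    unfolding norm_F using mult_right_mono[OF that, of "exp (- (C0 + 5 * (1 + H z)))"]
    by (simp flip: exp_add)
  have "cmod (F \<xi>) \<le> 1"
  proof (rule maximum_modulus_frontier[of F S])
    show "F holomorphic_on interior S"
      using holomorphic_on_subset[OF F_hol S_sub] S_open by (simp add: interior_open)
    show "continuous_on (closure S) F" by (rule continuous_on_subset[OF F_cont S_cl])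
    show "bounded S" by (rule bounded_subset[OF bounded_ball S_sub])
    show "\<xi> \<in> S" using \<xi> by (simp add: S_def \<phi>_def H_def E_def)
    fix z assume zf: "z \<in> frontier S"
    then have z_cl: "z \<in> closure S" and z_notin: "z \<notin> S"
      using S_open by (auto simp: frontier_def interior_open)
    have z1: "cmod z \<le> 1" using z_cl S_cl by auto
    show "cmod (F z) \<le> 1"
    \<comment> \<open>Close to 1 the top level \<open>4 ^ m\<close> of the barrier alone exceeds the
      crude bound on \<open>q\<close>. This case includes the point 1, where \<open>cay\<close> is
      singular.\<close>
    proof (cases "r m * cmod (1 - z) \<le> 2")
      case True
      then have "4 ^ m \<le> H z" using H_ge[of z m] z1 am by simp
      then have "exp (4 ^ m) \<le> exp (C0 + 5 * (1 + H z))" using C0 H0[OF z1] by simp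
      then show ?thesis using B[OF z1] by (intro small) linarith
    next
      case far: False
      then have "z \<noteq> 1" by auto
      have \<phi>_ge: "0 \<le> \<phi> z"
      proof -
        obtain x where x: "\<And>n. x n \<in> S" "x \<longlonglongrightarrow> z"
          using z_cl closure_sequential by blast
        have "(\<lambda>n. \<phi> (x n)) \<longlonglongrightarrow> \<phi> z"
        proof (rule continuous_on_tendsto_compose[OF \<phi>_cont x(2)])
          have "x n \<in> cball 0 1 - {1}" for n using x(1)[of n] by (auto simp: S_def)
          then show "eventually (\<lambda>n. x n \<in> cball 0 1 - {1}) sequentially" by simp
        qed (use z1 \<open>z \<noteq> 1\<close> in auto)
        then show ?thesis
        proof (rule LIMSEQ_le_const)
          have "0 \<le> \<phi> (x n)" for n using x(1)[of n] by (simp add: S_def)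
          then show "\<exists>N. \<forall>n\<ge>N. 0 \<le> \<phi> (x n)" by blast
        qed
      qed
      \<comment> \<open>On the circle \<open>Re (cay z)\<close> vanishes, so it cannot reach
        \<open>1 + H z\<close>.\<close>
      have "cmod z \<noteq> 1"
      proof
        assume "cmod z = 1"
        then have "Re (cay z) = 0" by (simp add: Re_cay)
        then show False using \<phi>_ge H0[OF z1] by (simp add: \<phi>_def)
      qed
      then have z: "cmod z < 1" using z1 by simp
      then have "\<phi> z \<le> 0" using z_notin by (auto simp: S_def not_less)
      then have Re_eq: "Re (cay z) = 1 + H z" using \<phi>_ge by (simp add: \<phi>_def)
      define t where "t = 1 - cmod z"
      have t: "t \<in> {0<..1}" using z by (simp add: t_def)
      have t_ge: "Re (cay z) * (cmod (1 - z))\<^sup>2 / 2 \<le> t"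
      proof -
        have "0 < cmod (1 - z)" using \<open>z \<noteq> 1\<close> by simp
        then have "Re (cay z) * (cmod (1 - z))\<^sup>2 = 1 - (cmod z)\<^sup>2" by (simp add: Re_cay)
        also have "\<dots> = (1 + cmod z) * t" by (simp add: t_def power2_eq_square algebra_simps)
        also have "\<dots> \<le> 2 * t" using z t by (intro mult_right_mono) auto
        finally show ?thesis by simp
      qed
      have t_lower: "2 * X / (r k)\<^sup>2 \<le> t" if "2 < r k * cmod (1 - z)" "0 \<le> X" "X \<le> Re (cay z)" for X k
      proof -
        have "(2 / r k)\<^sup>2 \<le> (cmod (1 - z))\<^sup>2"
          using that(1) r[of k] by (intro power_mono) (auto simp: field_simps)
        then have "X * (2 / r k)\<^sup>2 \<le> Re (cay z) * (cmod (1 - z))\<^sup>2"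
          using that by (intro mult_mono) auto
        then have "X * (2 / r k)\<^sup>2 / 2 \<le> t" using t_ge by linarith
        then show ?thesis by (simp add: power_divide)
      qed
      have "growth t \<le> C0 + 4 * H z"
      proof (cases "\<exists>k\<in>{a..m}. r k * cmod (1 - z) \<le> 2")
        case False
        then have "2 < r a * cmod (1 - z)" using am by (auto simp: not_le)
        from t_lower[OF this, of 1] have "2 / (r a)\<^sup>2 \<le> t" using Re_eq H0[OF z1] by simp
        then show ?thesis using C0(2)[OF t] H0[OF z1] by simp
      next
        case True
        \<comment> \<open>The highest level that is active at \<open>z\<close>. It gives
          \<open>4 ^ k \<le> H z\<close>, while inactivity of level \<open>Suc k\<close> keeps
          \<open>z\<close> far enough from the circle for growth at most
          \<open>4 ^ Suc k\<close>.\<close>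
        define k where "k = Max {k \<in> {a..m}. r k * cmod (1 - z) \<le> 2}"
        have fin: "finite {k \<in> {a..m}. r k * cmod (1 - z) \<le> 2}" by simp
        have "k \<in> {k \<in> {a..m}. r k * cmod (1 - z) \<le> 2}"
          unfolding k_def by (rule Max_in[OF fin]) (use True in blast)
        then have k: "a \<le> k" "k \<le> m" "r k * cmod (1 - z) \<le> 2" by auto
        have "k \<noteq> m" using k far by auto
        then have "Suc k \<in> {a..m}" using k by auto
        have "2 < r (Suc k) * cmod (1 - z)"
        proof (rule ccontr)
          assume "\<not> 2 < r (Suc k) * cmod (1 - z)"
          then have "Suc k \<le> k"
            unfolding k_def using \<open>Suc k \<in> {a..m}\<close> by (intro Max_ge) (auto simp: k_def)
          then show False by simp
        qed
        moreover have Hk: "4 ^ k \<le> H z" using H_ge[OF z1 k] .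
        ultimately have "2 * 4 ^ k / (r (Suc k))\<^sup>2 \<le> t"
          using Re_eq by (intro t_lower) auto
        from gap[OF t this] show ?thesis using Hk C0 by simp
      qed
      then have "Re (cay z) + growth t \<le> C0 + 5 * (1 + H z)" using Re_eq by simp
      then have "exp (Re (cay z) + growth t) \<le> exp (C0 + 5 * (1 + H z))" by simp
      then show ?thesis using q[OF z] unfolding t_def by (intro small) linarith
    qed
  qed
  then have "cmod (F \<xi>) * exp (C0 + 5 * (1 + H \<xi>)) \<le> 1 * exp (C0 + 5 * (1 + H \<xi>))"
    by (rule mult_right_mono) simp
  then show ?thesis
    unfolding norm_F mult.assoc exp_add[symmetric] by (simp add: H_def E_def)
qed

text \<open>The order of choices matters: \<open>r\<close>, \<open>a\<close>, \<open>C0\<close> and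
  the test point \<open>x\<close> depend on the weight only, then the tolerance \<open>e\<close>,
  then \<open>q\<close>. Only \<open>m\<close> depends on \<open>q\<close>, and the final estimate
  does not involve \<open>m\<close>.\<close>

lemma not_approximable_one_of_convergence:
  assumes fin: "(\<integral>\<^sup>+ t \<in> {0<..1}. ennreal (sqrt (\<Lambda> t / t)) \<partial>lborel) < \<infinity>"
  shows "\<not> approximable (\<lambda>z. 1)"
proof
  assume approximable: "approximable (\<lambda>z. 1)"
  have "\<exists>T. 0 \<le> T \<and> T \<le> 1 \<and> (\<forall>t\<in>{0<..1}. (t < T \<longrightarrow> 1 * 4 ^ k \<le> growth t) \<and> (1 * 4 ^ k \<le> growth t \<longrightarrow> t \<le> T))" for k :: nat
    by (rule antimono_threshold[OF growth_antimono, of "1 * 4 ^ k"]) blast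
  then obtain T where T: "\<And>k::nat. 0 \<le> T k \<and> T k \<le> 1 \<and>
      (\<forall>t\<in>{0<..1}. (t < T k \<longrightarrow> 1 * 4 ^ k \<le> growth t) \<and> (1 * 4 ^ k \<le> growth t \<longrightarrow> t \<le> T k))"
    by metis
  interpret threshold growth 1 T
    by unfold_locales (use growth_pos T in auto)
  have sm: "summable (\<lambda>k. 2 ^ k * sqrt (T k))"
    by (rule finite_integral_imp_summable[OF growth_integral_finite[OF fin]])
  \<comment> \<open>At \<open>t = (1 / 4 ^ k)\<^sup>2\<close> the term \<open>4 / sqrt t\<close>
    already exceeds the level \<open>4 ^ k\<close>.\<close>
  have T_pos: "0 < T k" for k
  proof -
    define t :: real where "t = (1 / 4 ^ k)\<^sup>2"
    have t: "t \<in> {0<..1}" by (simp add: t_def power_le_one)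
    have "sqrt t = 1 / 4 ^ k" by (simp add: t_def)
    then have "4 / sqrt t = 4 * 4 ^ k" by simp
    moreover have "0 \<le> p * \<Lambda> (t / 2)" using p pos[of "t / 2"] t by simp
    ultimately have "1 * 4 ^ k \<le> growth t" by (simp add: growth_def)
    from T_upper[OF t this] show ?thesis using t by simp
  qed
  \<comment> \<open>Serves two purposes: \<open>4 ^ Suc k / r k\<close> is a multiple of the
    summable terms, and \<open>2 * 4 ^ k / (r (Suc k))\<^sup>2\<close> equals
    \<open>2 * T (Suc k)\<close>, strictly beyond the threshold.\<close>
  define r where "r k = 2 ^ k / (2 * sqrt (T k))" for k
  have r: "0 < r k" for k using T_pos by (simp add: r_def)
  have ratio: "4 ^ Suc k / r k = 8 * (2 ^ k * sqrt (T k))" for k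
  proof -
    have "(4::real) ^ k = 2 ^ k * 2 ^ k" by (simp flip: power_mult_distrib)
    then show ?thesis using T_pos[of k] by (simp add: r_def field_simps)
  qed
  have gap: "growth t \<le> 4 ^ Suc k" if t: "t \<in> {0<..1}" "2 * 4 ^ k / (r (Suc k))\<^sup>2 \<le> t" for k t
  proof -
    have "(r (Suc k))\<^sup>2 = 4 ^ k / T (Suc k)"
    proof -
      have "((2::real) ^ k)\<^sup>2 = 4 ^ k" by (simp add: power2_eq_square flip: power_mult_distrib)
      then show ?thesis using T_pos[of "Suc k"] by (simp add: r_def power_divide)
    qed
    then have "2 * T (Suc k) \<le> t" using t(2) by simp
    then have "T (Suc k) < t" using T_pos[of "Suc k"] by simp
    then show ?thesis using T_upper[OF t(1), of "Suc k"] by (cases "4 ^ Suc k \<le> growth t") auto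
  qed
  obtain a where a: "\<And>m. (\<Sum>k\<in>{a..m}. 4 ^ Suc k / r k) \<le> 1 / 20"
  proof -
    have "summable (\<lambda>k. 4 ^ Suc k / r k)" unfolding ratio by (intro summable_mult sm)
    then obtain N where N: "\<And>m n. N \<le> m \<Longrightarrow> norm (\<Sum>k\<in>{m..<n}. 4 ^ Suc k / r k) < 1 / 20"
      unfolding summable_Cauchy by (metis zero_less_divide_1_iff zero_less_numeral)
    show thesis
    proof (rule that)
      show "(\<Sum>k\<in>{N..m}. 4 ^ Suc k / r k) \<le> 1 / 20" for m
        using N[of N "Suc m"] by (simp add: atLeastLessThanSuc_atLeastAtMost)
    qed
  qed
  \<comment> \<open>Bounds the growth where no level from \<open>a\<close> on is active; the minimum
    keeps the argument inside the interval where \<open>growth\<close> is monotone.\<close>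
  define C0 where "C0 = growth (min 1 (2 / (r a)\<^sup>2))"
  have t0: "min 1 (2 / (r a)\<^sup>2) \<in> {0<..1}" using r[of a] by simp
  have C0_nonneg: "0 \<le> C0" unfolding C0_def using growth_pos[OF t0] by simp
  have C0: "growth t \<le> C0" if "t \<in> {0<..1}" "2 / (r a)\<^sup>2 \<le> t" for t
    unfolding C0_def using that t0 by (intro monotone_onD[OF growth_antimono]) auto
  \<comment> \<open>The value of \<open>1 + cay\<close> at the test point. The contradiction needs
    \<open>w - 2 > C0 + 5 * (1 + w / 20)\<close>, that is \<open>3 * w / 4 > C0 + 7\<close>.\<close>
  define w where "w = 2 * C0 + 20"
  have w: "20 \<le> w" using C0_nonneg by (simp add: w_def)
  define x where "x = 1 - 2 / w"
  have x: "0 \<le> x" "x < 1" "2 / (1 - x) = w" using w by (auto simp: x_def field_simps)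
  have norm_x: "cmod (of_real x) < 1" using x by simp
  have cay_x: "cay (of_real x) = of_real (w - 1)"
  proof -
    have "(1 + x) / (1 - x) = w - 1" using w by (simp add: x_def field_simps)
    then show ?thesis unfolding cay_def by (metis of_real_1 of_real_add of_real_diff of_real_divide)
  qed
  define M where "M = 4 * exp (p * \<Lambda> ((1 - x) / 2)) / (pi * (1 - x)\<^sup>2)"
  have M: "0 < M" using x by (simp add: M_def)
  \<comment> \<open>With \<open>\<eta> = 1 / 4\<close> this makes the error at \<open>x\<close> at
    most \<open>1 / 2\<close>; \<open>e \<le> 1\<close> serves the growth bound with
    \<open>\<eta> = 1\<close>.\<close>
  define e where "e = min 1 ((1 / 4) powr p / M)"
  have e: "0 < e" "e \<le> 1" "M * (e / (1 / 4) powr p) \<le> 1"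
    using M by (auto simp: e_def field_simps min_def)
  obtain q where q: "wi (\<lambda>z. poly q z * atomic_inner z - 1) < ennreal e"
    using approximable e unfolding approximable_def by blast
  define f where "f z = poly q z * atomic_inner z - 1" for z
  have f: "f holomorphic_on ball 0 1"
    unfolding f_def by (intro holomorphic_intros atomic_inner_holomorphic)
  have wf: "wi f \<le> ennreal e" unfolding f_def using q by simp
  have poly_eq: "poly q z = (1 + f z) * exp (cay z)" for z
    by (simp add: f_def atomic_inner_cay exp_minus)
  have norm_poly: "cmod (poly q z) = cmod (1 + f z) * exp (Re (cay z))" for z
    by (simp add: poly_eq norm_mult)
  have q_bound: "cmod (poly q z) \<le> exp (Re (cay z) + growth (1 - cmod z))" if z: "cmod z < 1" for z
  proof -
    define t where "t = 1 - cmod z"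
    have t: "t \<in> {0<..1}" using z by (simp add: t_def)
    have "cmod (f z) \<le> 1 * (1 + 4 * exp (p * \<Lambda> (t / 2)) / (pi * t\<^sup>2) * (1 / 1 powr p))"
      unfolding t_def
      by (rule pointwise_bound[OF f order_trans[OF wf ennreal_leI[OF e(2)]] _ z]) auto
    then have "cmod (1 + f z) \<le> 2 + 4 * exp (p * \<Lambda> (t / 2)) / (pi * t\<^sup>2)"
      using norm_triangle_ineq[of 1 "f z"] by simp
    also have "\<dots> \<le> exp (growth t)" by (rule bound_le_exp_growth[OF t])
    finally have "cmod (poly q z) \<le> exp (growth t) * exp (Re (cay z))"
      unfolding norm_poly by (intro mult_right_mono) auto
    then show ?thesis by (simp add: t_def exp_add mult.commute)
  qed
  have "compact (poly q ` cball 0 1)"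
    by (intro compact_continuous_image continuous_intros) auto
  then obtain B where B: "\<And>z. z \<in> cball 0 1 \<Longrightarrow> cmod (poly q z) \<le> B"
    using compact_imp_bounded bounded_iff by (metis (no_types, lifting) imageI)
  \<comment> \<open>A level beyond the supremum of the polynomial on the closed disc, for use near
    the point 1.\<close>
  obtain n where n: "B < 4 ^ n" using real_arch_pow[of 4 B] by auto
  define m where "m = max a n"
  have Bm: "cmod (poly q z) \<le> exp (4 ^ m)" if "cmod z \<le> 1" for z
  proof -
    have "cmod (poly q z) \<le> 4 ^ n" using B[of z] n that by simp
    also have "\<dots> \<le> 4 ^ m" by (intro power_increasing) (auto simp: m_def)
    also have "\<dots> \<le> exp (4 ^ m)" using exp_ge_add_one_self[of "4 ^ m :: real"] by linarith
    finally show ?thesis .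
  qed
  define h where "h = Re (barrier r {a..m} (of_real x))"
  have h: "h \<le> w / 20"
  proof -
    have "h \<le> (\<Sum>k\<in>{a..m}. 4 ^ Suc k / r k) * w"
      unfolding h_def x(3)[symmetric] by (rule barrier_real_le[OF x(1,2) r])
    also have "\<dots> \<le> 1 / 20 * w" using a w by (intro mult_right_mono) auto
    finally show ?thesis by simp
  qed
  have "1 + h < Re (cay (of_real x))" using h w by (simp add: cay_x)
  then have upper: "cmod (poly q (of_real x)) \<le> exp (C0 + 5 * (1 + h))"
    unfolding h_def
    by (intro poly_le_exp_barrier[OF r gap C0_nonneg C0 q_bound Bm _ norm_x]) (auto simp: m_def)
  have "cmod (f (of_real x)) \<le> 1 / 4 * (1 + M * (e / (1 / 4) powr p))"
    using pointwise_bound[OF f wf _ norm_x, of "1 / 4"] e x by (simp add: M_def)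
  also have "\<dots> \<le> 1 / 4 * (1 + 1)" using e(3) by (intro mult_left_mono add_left_mono) auto
  finally have "1 / 2 \<le> cmod (1 + f (of_real x))"
    using norm_diff_ineq[of 1 "f (of_real x)"] by simp
  moreover have "exp (- 1) \<le> (1 / 2 :: real)"
    using exp_ge_add_one_self[of "1::real"] by (simp add: exp_minus field_simps)
  ultimately have "exp (- 1) * exp (w - 1) \<le> cmod (poly q (of_real x))"
    unfolding norm_poly cay_x by (intro mult_mono) auto
  also note upper
  finally have "exp (w - 2) \<le> exp (C0 + 5 * (1 + h))"
    by (simp flip: exp_add)
  then have "w - 2 \<le> C0 + 5 * (1 + h)" by simp
  then show False using h C0_nonneg by (simp add: w_def)
qed

end

theorem theorem2:
  fixes p :: real and \<Lambda> :: "real \<Rightarrow> real"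
  assumes "1 \<le> p"
    and "\<And>t. t \<in> {0<..1} \<Longrightarrow> 0 < \<Lambda> t"
    and "antimono_on {0<..1} \<Lambda>"
    and "continuous_on {0<..1} \<Lambda>"
  shows "cyclic_in (weighted_Bergman \<Lambda> p) (weighted_norm \<Lambda> p) atomic_inner
    \<longleftrightarrow> (\<integral>\<^sup>+ t \<in> {0<..1}. ennreal (sqrt (\<Lambda> t / t)) \<partial>lborel) = \<infinity>"
proof -
  interpret radial_weight p \<Lambda>
    using assms by unfold_locales auto
  show ?thesis
    using approximable_one_of_divergence not_approximable_one_of_convergence cyclic_iff_approximable_one
    by (metis infinity_ennreal_def less_top)
qed

end
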